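(* Let $X$ be a simplicial complex. Then the edge-path groupoid $\mathcal{E}X$ is isomorphic to the intrinsic fundamental groupoid $\Pi X$. More precisely, assigning to an edge path $a=(a_0,\dots,a_h)$ of $X$ the path $\hat a:\mathbf{Z}\to X$, $\hat a(i)=a_{(0\vee i)\wedge h}$, induces a functor $\mathcal{E}X\to\Pi X$, identical on objects, which is an isomorphism of groupoids.
   Context: **Simplicial complexes.** A simplicial complex is a set $X$ with a family $!X$ of finite subsets (linked parts) containing $\emptyset$ and all singletons and closed under taking subsets. One writes $x\,!\,y$ if $\{x,y\}$ is linked. A map sends linked parts to linked parts. A finite subset of a product is linked iff its projections are. $\mathbf{Z}$ is the set of integers with linked parts $\emptyset$, singletons and pairs $\{i,i+1\}$; $\mathbf{Z}^2$ has the product structure. $\vee,\wedge$ denote maximum and minimum of integers. **Intrinsic fundamental groupoid.** A path in $X$ is a map $a:\mathbf{Z}\to X$ for which there are integers $\rho^-\le\rho^+$ (the interval $[\rho^-,\rho^+]$ is called a support) with $a$ constant on $]-\infty,\rho^-]$ and on $[\rho^+,\infty[$; its end points are $\partial^{\pm}a=a(\rho^{\pm})$. The standard support $[\rho^-(a),\rho^+(a)]$ is the least support (and $[0,0]$ if $a$ is constant). If $\partial^+a=\partial^-b$, the concatenation $a+b$ is the path $c$ with $c(i)=a(i-\rho^-(b))$ for $i\le\rho^+(a)+\rho^-(b)$ and $c(i)=b(i-\rho^+(a))$ for $i\ge\rho^+(a)+\rho^-(b)$. Two paths $a,b$ from $x$ to $x'$ are 2-homotopic, $a\simeq_2b$,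 if there is a map $A:\mathbf{Z}^2\to X$ and integers $\rho^-\le\rho^+$, $\sigma^-\le\sigma^+$ such that $A(i,j)=x$ for $i\le\rho^-$, $A(i,j)=x'$ for $i\ge\rho^+$, $A(i,j)=a(i)$ for $j\le\sigma^-$ and $A(i,j)=b(i)$ for $j\ge\sigma^+$. $\Pi X$ is the groupoid with objects the points of $X$ and arrows the $\simeq_2$-classes $[a]:\partial^-a\to\partial^+a$, with composition $[a]+[b]=[a+b]$, identities the classes of constant paths, and inverses given by $(-a)(i)=a(-i)$. **Edge-path groupoid.** An edge path in $X$ is a finite non-empty sequence $a=(a_0,\dots,a_h)$ of points with $a_{i-1}\,!\,a_i$ for $i=1,\dots,h$, going from $a_0$ to $a_h$. The concatenation of $a$ with $b=(b_0,\dots,b_k)$, where $a_h=b_0$, is $a+b=(a_0,\dots,a_h,b_1,\dots,b_k)$; the reverse of $a$ is $(a_h,\dots,a_0)$. Two edge paths are simply equivalent if they only differ by the repetition of a point, or if they can be expressed (in either order) as $c+(x,y,z)+d$ and $c+(x,z)+d$, where $c,d$ are edge paths and $\{x,y,z\}$ is a linked part of $X$. $\mathcal{E}X$ is the groupoid with objects the points of $X$ and arrows the classes of edge paths modulo the equivalence relation generated by simple equivalence, with composition induced by concatenation and inverses by reversal. *)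

theory Defs
  imports Main
begin

section \<open>Simplicial complexes\<close>

record 'a scomplex =
  points :: "'a set"
  linked :: "'a set set"

locale simplicial_complex =
  fixes X :: "'a scomplex"
  assumes linked_finite: "S \<in> linked X \<Longrightarrow> finite S"
    and linked_subset: "S \<in> linked X \<Longrightarrow> S \<subseteq> points X"
    and linked_empty: "{} \<in> linked X"
    and linked_singleton: "x \<in> points X \<Longrightarrow> {x} \<in> linked X"
    and linked_mono: "S \<in> linked X \<Longrightarrow> T \<subseteq> S \<Longrightarrow> T \<in> linked X"

definition scomplex_map :: "'a scomplex \<Rightarrow> 'b scomplex \<Rightarrow> ('a \<Rightarrow> 'b) \<Rightarrow> bool" where
  "scomplex_map X Y f \<longleftrightarrow>
     (\<forall>x \<in> points X. f x \<in> points Y) \<and> (\<forall>S \<in> linked X. f ` S \<in> linked Y)"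

definition prod_scomplex :: "'a scomplex \<Rightarrow> 'b scomplex \<Rightarrow> ('a \<times> 'b) scomplex" where
  "prod_scomplex X Y =
     \<lparr> points = points X \<times> points Y,
       linked = {S. finite S \<and> S \<subseteq> points X \<times> points Y \<and>
                    fst ` S \<in> linked X \<and> snd ` S \<in> linked Y} \<rparr>"

definition int_line :: "int scomplex" where
  "int_line =
     \<lparr> points = UNIV,
       linked = {{}} \<union> {{i} | i. True} \<union> {{i, i + 1} | i. True} \<rparr>"


section \<open>Groupoids\<close>

text \<open>
  Composition is written in diagrammatic order: \<open>cmp G f g\<close> is meaningful when the target
  of \<open>f\<close> is the source of \<open>g\<close>.
\<close>

record ('o, 'm) groupoid_data =
  obj :: "'o set"
  arr :: "'m set"
  src :: "'m \<Rightarrow> 'o"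
  trg :: "'m \<Rightarrow> 'o"
  cmp :: "'m \<Rightarrow> 'm \<Rightarrow> 'm"
  ident :: "'o \<Rightarrow> 'm"
  inv_arr :: "'m \<Rightarrow> 'm"

locale groupoid =
  fixes G :: "('o, 'm) groupoid_data"
  assumes src_obj: "f \<in> arr G \<Longrightarrow> src G f \<in> obj G"
    and trg_obj: "f \<in> arr G \<Longrightarrow> trg G f \<in> obj G"
    and ident_arr: "x \<in> obj G \<Longrightarrow> ident G x \<in> arr G"
    and src_ident: "x \<in> obj G \<Longrightarrow> src G (ident G x) = x"
    and trg_ident: "x \<in> obj G \<Longrightarrow> trg G (ident G x) = x"
    and cmp_arr: "f \<in> arr G \<Longrightarrow> g \<in> arr G \<Longrightarrow> trg G f = src G g \<Longrightarrow> cmp G f g \<in> arr G"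
    and src_cmp: "f \<in> arr G \<Longrightarrow> g \<in> arr G \<Longrightarrow> trg G f = src G g \<Longrightarrow> src G (cmp G f g) = src G f"
    and trg_cmp: "f \<in> arr G \<Longrightarrow> g \<in> arr G \<Longrightarrow> trg G f = src G g \<Longrightarrow> trg G (cmp G f g) = trg G g"
    and cmp_assoc: "f \<in> arr G \<Longrightarrow> g \<in> arr G \<Longrightarrow> h \<in> arr G \<Longrightarrow>
           trg G f = src G g \<Longrightarrow> trg G g = src G h \<Longrightarrow>
           cmp G (cmp G f g) h = cmp G f (cmp G g h)"
    and ident_cmp: "f \<in> arr G \<Longrightarrow> cmp G (ident G (src G f)) f = f"
    and cmp_ident: "f \<in> arr G \<Longrightarrow> cmp G f (ident G (trg G f)) = f"
    and inv_arr_arr: "f \<in> arr G \<Longrightarrow> inv_arr G f \<in> arr G"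
    and src_inv: "f \<in> arr G \<Longrightarrow> src G (inv_arr G f) = trg G f"
    and trg_inv: "f \<in> arr G \<Longrightarrow> trg G (inv_arr G f) = src G f"
    and cmp_inv: "f \<in> arr G \<Longrightarrow> cmp G f (inv_arr G f) = ident G (src G f)"
    and inv_cmp: "f \<in> arr G \<Longrightarrow> cmp G (inv_arr G f) f = ident G (trg G f)"

locale groupoid_functor = G: groupoid G + H: groupoid H
  for G :: "('o, 'm) groupoid_data" and H :: "('p, 'n) groupoid_data" +
  fixes Fo :: "'o \<Rightarrow> 'p" and Fm :: "'m \<Rightarrow> 'n"
  assumes map_obj: "x \<in> obj G \<Longrightarrow> Fo x \<in> obj H"
    and map_arr: "f \<in> arr G \<Longrightarrow> Fm f \<in> arr H"
    and map_src: "f \<in> arr G \<Longrightarrow> src H (Fm f) = Fo (src G f)"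
    and map_trg: "f \<in> arr G \<Longrightarrow> trg H (Fm f) = Fo (trg G f)"
    and map_ident: "x \<in> obj G \<Longrightarrow> Fm (ident G x) = ident H (Fo x)"
    and map_cmp: "f \<in> arr G \<Longrightarrow> g \<in> arr G \<Longrightarrow> trg G f = src G g \<Longrightarrow>
           Fm (cmp G f g) = cmp H (Fm f) (Fm g)"

definition groupoid_iso ::
    "('o, 'm) groupoid_data \<Rightarrow> ('p, 'n) groupoid_data \<Rightarrow> ('o \<Rightarrow> 'p) \<Rightarrow> ('m \<Rightarrow> 'n) \<Rightarrow> bool" where
  "groupoid_iso G H Fo Fm \<longleftrightarrow>
     groupoid_functor G H Fo Fm \<and>
     (\<exists>Ko Km. groupoid_functor H G Ko Km \<and>
        (\<forall>x \<in> obj G. Ko (Fo x) = x) \<and> (\<forall>f \<in> arr G. Km (Fm f) = f) \<and>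
        (\<forall>y \<in> obj H. Fo (Ko y) = y) \<and> (\<forall>g \<in> arr H. Fm (Km g) = g))"

definition groupoids_isomorphic ::
    "('o, 'm) groupoid_data \<Rightarrow> ('p, 'n) groupoid_data \<Rightarrow> bool" where
  "groupoids_isomorphic G H \<longleftrightarrow> (\<exists>Fo Fm. groupoid_iso G H Fo Fm)"


section \<open>The intrinsic fundamental groupoid\<close>

definition path_support :: "(int \<Rightarrow> 'a) \<Rightarrow> int \<Rightarrow> int \<Rightarrow> bool" where
  "path_support a m p \<longleftrightarrow> m \<le> p \<and> (\<forall>i \<le> m. a i = a m) \<and> (\<forall>i \<ge> p. a i = a p)"

definition paths :: "'a scomplex \<Rightarrow> (int \<Rightarrow> 'a) set" where
  "paths X = {a. scomplex_map int_line X a \<and> (\<exists>m p. path_support a m p)}"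

definition std_support :: "(int \<Rightarrow> 'a) \<Rightarrow> int \<times> int" where
  "std_support a =
     (if \<exists>x. \<forall>i. a i = x then (0, 0)
      else THE (m, p). path_support a m p \<and>
             (\<forall>m' p'. path_support a m' p' \<longrightarrow> {m..p} \<subseteq> {m'..p'}))"

definition rho_minus :: "(int \<Rightarrow> 'a) \<Rightarrow> int" where
  "rho_minus a = fst (std_support a)"

definition rho_plus :: "(int \<Rightarrow> 'a) \<Rightarrow> int" where
  "rho_plus a = snd (std_support a)"

definition end_minus :: "(int \<Rightarrow> 'a) \<Rightarrow> 'a" where
  "end_minus a = a (rho_minus a)"

definition end_plus :: "(int \<Rightarrow> 'a) \<Rightarrow> 'a" where
  "end_plus a = a (rho_plus a)"

text \<open>
  If the end points match, the two branches below agree at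
  \<open>i = rho_plus a + rho_minus b\<close>.
\<close>

definition path_concat :: "(int \<Rightarrow> 'a) \<Rightarrow> (int \<Rightarrow> 'a) \<Rightarrow> (int \<Rightarrow> 'a)" where
  "path_concat a b =
     (\<lambda>i. if i \<le> rho_plus a + rho_minus b then a (i - rho_minus b) else b (i - rho_plus a))"

definition path_reverse :: "(int \<Rightarrow> 'a) \<Rightarrow> (int \<Rightarrow> 'a)" where
  "path_reverse a = (\<lambda>i. a (- i))"

definition homotopic2 :: "'a scomplex \<Rightarrow> ((int \<Rightarrow> 'a) \<times> (int \<Rightarrow> 'a)) set" where
  "homotopic2 X =
     {(a, b). a \<in> paths X \<and> b \<in> paths X \<and>
        (\<exists>x x'. end_minus a = x \<and> end_minus b = x \<and> end_plus a = x' \<and> end_plus b = x' \<and>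
          (\<exists>A rm rp sm sp.
             scomplex_map (prod_scomplex int_line int_line) X A \<and> rm \<le> rp \<and> sm \<le> sp \<and>
             (\<forall>i j. i \<le> rm \<longrightarrow> A (i, j) = x) \<and>
             (\<forall>i j. i \<ge> rp \<longrightarrow> A (i, j) = x') \<and>
             (\<forall>i j. j \<le> sm \<longrightarrow> A (i, j) = a i) \<and>
             (\<forall>i j. j \<ge> sp \<longrightarrow> A (i, j) = b i)))}"

definition path_class :: "'a scomplex \<Rightarrow> (int \<Rightarrow> 'a) \<Rightarrow> (int \<Rightarrow> 'a) set" where
  "path_class X a = homotopic2 X `` {a}"

text \<open>
  The operations on classes are the operations induced by representatives. Composition and
  inverse collect the classes of all results, so that the axioms \<open>cmp_arr\<close> and
  \<open>inv_arr_arr\<close> of a groupoid, which require a single class, express their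
  independence of the representatives.
\<close>

definition fundamental_groupoid :: "'a scomplex \<Rightarrow> ('a, (int \<Rightarrow> 'a) set) groupoid_data" where
  "fundamental_groupoid X =
     \<lparr> obj = points X,
       arr = paths X // homotopic2 X,
       src = (\<lambda>\<alpha>. THE x. \<exists>a \<in> \<alpha>. end_minus a = x),
       trg = (\<lambda>\<alpha>. THE x. \<exists>a \<in> \<alpha>. end_plus a = x),
       cmp = (\<lambda>\<alpha> \<beta>. \<Union>{path_class X (path_concat a b) | a b.
                          a \<in> \<alpha> \<and> b \<in> \<beta> \<and> end_plus a = end_minus b}),
       ident = (\<lambda>x. path_class X (\<lambda>_. x)),
       inv_arr = (\<lambda>\<alpha>. \<Union>{path_class X (path_reverse a) | a. a \<in> \<alpha>}) \<rparr>"


section \<open>The edge-path groupoid\<close>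

definition edge_paths :: "'a scomplex \<Rightarrow> 'a list set" where
  "edge_paths X =
     {a. a \<noteq> [] \<and> set a \<subseteq> points X \<and>
         (\<forall>i. Suc i < length a \<longrightarrow> {a ! i, a ! Suc i} \<in> linked X)}"

text \<open>Meaningful when \<open>last a = hd b\<close>; the shared point is kept once.\<close>

definition edge_concat :: "'a list \<Rightarrow> 'a list \<Rightarrow> 'a list" where
  "edge_concat a b = a @ tl b"

inductive simple_step :: "'a scomplex \<Rightarrow> 'a list \<Rightarrow> 'a list \<Rightarrow> bool" for X where
  repetition: "us @ [x] @ vs \<in> edge_paths X \<Longrightarrow>
     simple_step X (us @ [x] @ vs) (us @ [x, x] @ vs)"
| triangle: "c \<in> edge_paths X \<Longrightarrow> d \<in> edge_paths X \<Longrightarrow> last c = x \<Longrightarrow> hd d = z \<Longrightarrow>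
     {x, y, z} \<in> linked X \<Longrightarrow>
     simple_step X (edge_concat (edge_concat c [x, y, z]) d)
                   (edge_concat (edge_concat c [x, z]) d)"

text \<open>Simple equivalence is the symmetric closure of \<open>simple_step X\<close>.\<close>

definition edge_equiv :: "'a scomplex \<Rightarrow> ('a list \<times> 'a list) set" where
  "edge_equiv X =
     {(a, b). a \<in> edge_paths X \<and> b \<in> edge_paths X \<and> equivclp (simple_step X) a b}"

definition edge_class :: "'a scomplex \<Rightarrow> 'a list \<Rightarrow> 'a list set" where
  "edge_class X a = edge_equiv X `` {a}"

definition edge_groupoid :: "'a scomplex \<Rightarrow> ('a, 'a list set) groupoid_data" where
  "edge_groupoid X =
     \<lparr> obj = points X,
       arr = edge_paths X // edge_equiv X,
       src = (\<lambda>\<alpha>. THE x. \<exists>a \<in> \<alpha>. hd a = x),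
       trg = (\<lambda>\<alpha>. THE x. \<exists>a \<in> \<alpha>. last a = x),
       cmp = (\<lambda>\<alpha> \<beta>. \<Union>{edge_class X (edge_concat a b) | a b.
                          a \<in> \<alpha> \<and> b \<in> \<beta> \<and> last a = hd b}),
       ident = (\<lambda>x. edge_class X [x]),
       inv_arr = (\<lambda>\<alpha>. \<Union>{edge_class X (rev a) | a. a \<in> \<alpha>}) \<rparr>"

definition edge_path_hat :: "'a list \<Rightarrow> (int \<Rightarrow> 'a)" where
  "edge_path_hat a = (\<lambda>i. a ! nat (min (max 0 i) (int (length a - 1))))"

end

theory Submission
  imports Defs
begin

text \<open>
  Both groupoids are quotients of structures that satisfy the groupoid laws up to equivalence.
  Restricting a path to its standard support gives an edge path, and \<open>a \<simeq>\<^sub>2 b\<close> holds if and only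
  if the two restrictions are equivalent edge paths; hence all groupoid laws transfer from edge
  paths to paths. If \<open>f\<close> and \<open>g\<close> are consecutive rows of a homotopy, then
  \<open>(f\<^sub>m, \<dots>, f\<^sub>k, g\<^sub>k, \<dots>, g\<^sub>p)\<close> turns into the same sequence with \<open>k + 1\<close> for \<open>k\<close> by two triangle
  moves. Conversely, a triangle move changes a path at a single point, up to a repetition, and
  repeating a point is a delay, which can be pushed past the end of the support one place at a
  time, each step being a homotopy; translations are compositions of such delays.
\<close>

section \<open>Quotients of groupoids up to equivalence\<close>

text \<open>Proving the laws of paths directly on the integer plane meets an obstacle: homotopic
  paths may have different standard supports, so concatenations of homotopic paths can have their
  seams at different places, and homotopies of the two pieces cannot simply be put side by side.
  Edge paths have no such problem, since a move is local in a finite sequence and survives any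
  context. The laws are therefore proved for sequences and transferred along restriction to the
  standard support, although the functor of the theorem goes the other way: homotopy is detected on
  restrictions, and the hat construction then inherits its properties from being inverse to
  restriction. All comparisons are only up to equivalence: restricting a hat cuts off repetitions at
  the two ends of the sequence, and the hat of a restriction is a translate of the original
  path.\<close>

lemma Union_constant_family:
  assumes "a \<in> A" "\<And>b. b \<in> A \<Longrightarrow> X b = X a"
  shows "\<Union>{X b | b. b \<in> A} = X a"
proof -
  have "{X b | b. b \<in> A} = {X a}" using assms by fast
  then show ?thesis by simp
qed

text \<open>This is the structure that sequences and paths carry before passing to classes: end
  points are strict and invariant under \<open>R\<close>, so composability depends on classes only,
  while associativity, units and inverses are required up to \<open>R\<close>.\<close>

locale setoid_groupoid =
  fixes P :: "'a set" and R :: "('a \<times> 'a) set" and Ob :: "'o set"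
    and s t :: "'a \<Rightarrow> 'o" and c :: "'a \<Rightarrow> 'a \<Rightarrow> 'a" and e :: "'o \<Rightarrow> 'a" and v :: "'a \<Rightarrow> 'a"
  assumes equiv: "equiv P R"
    and s_in: "a \<in> P \<Longrightarrow> s a \<in> Ob"
    and t_in: "a \<in> P \<Longrightarrow> t a \<in> Ob"
    and s_cong: "(a, b) \<in> R \<Longrightarrow> s a = s b"
    and t_cong: "(a, b) \<in> R \<Longrightarrow> t a = t b"
    and c_in: "a \<in> P \<Longrightarrow> b \<in> P \<Longrightarrow> t a = s b \<Longrightarrow> c a b \<in> P"
    and s_c: "a \<in> P \<Longrightarrow> b \<in> P \<Longrightarrow> t a = s b \<Longrightarrow> s (c a b) = s a"
    and t_c: "a \<in> P \<Longrightarrow> b \<in> P \<Longrightarrow> t a = s b \<Longrightarrow> t (c a b) = t b"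
    and c_cong: "(a, a') \<in> R \<Longrightarrow> (b, b') \<in> R \<Longrightarrow> t a = s b \<Longrightarrow> (c a b, c a' b') \<in> R"
    and c_assoc: "a \<in> P \<Longrightarrow> b \<in> P \<Longrightarrow> d \<in> P \<Longrightarrow> t a = s b \<Longrightarrow> t b = s d \<Longrightarrow>
      (c (c a b) d, c a (c b d)) \<in> R"
    and e_in: "x \<in> Ob \<Longrightarrow> e x \<in> P"
    and s_e: "x \<in> Ob \<Longrightarrow> s (e x) = x"
    and t_e: "x \<in> Ob \<Longrightarrow> t (e x) = x"
    and e_c: "a \<in> P \<Longrightarrow> (c (e (s a)) a, a) \<in> R"
    and c_e: "a \<in> P \<Longrightarrow> (c a (e (t a)), a) \<in> R"
    and v_in: "a \<in> P \<Longrightarrow> v a \<in> P"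
    and s_v: "a \<in> P \<Longrightarrow> s (v a) = t a"
    and t_v: "a \<in> P \<Longrightarrow> t (v a) = s a"
    and v_cong: "(a, b) \<in> R \<Longrightarrow> (v a, v b) \<in> R"
    and c_v: "a \<in> P \<Longrightarrow> (c a (v a), e (s a)) \<in> R"
    and v_c: "a \<in> P \<Longrightarrow> (c (v a) a, e (t a)) \<in> R"
begin

text \<open>The shape repeats that of the two given groupoids, operation by operation, so that each
  of them becomes an instance by unfolding definitions.\<close>

definition quotient :: "('o, 'a set) groupoid_data" where
  "quotient =
     \<lparr> obj = Ob,
       arr = P // R,
       src = (\<lambda>\<alpha>. THE x. \<exists>a \<in> \<alpha>. s a = x),
       trg = (\<lambda>\<alpha>. THE x. \<exists>a \<in> \<alpha>. t a = x),
       cmp = (\<lambda>\<alpha> \<beta>. \<Union>{R `` {c a b} | a b. a \<in> \<alpha> \<and> b \<in> \<beta> \<and> t a = s b}),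
       ident = (\<lambda>x. R `` {e x}),
       inv_arr = (\<lambda>\<alpha>. \<Union>{R `` {v a} | a. a \<in> \<alpha>}) \<rparr>"

lemma R_in: "(a, b) \<in> R \<Longrightarrow> a \<in> P \<and> b \<in> P"
  using equiv by (auto elim: equivE)

lemma R_refl: "a \<in> P \<Longrightarrow> (a, a) \<in> R"
  using equiv by (auto elim!: equivE dest: refl_onD)

lemma R_sym: "(a, b) \<in> R \<Longrightarrow> (b, a) \<in> R"
  using equiv by (auto elim!: equivE dest: symD)

lemma R_trans: "(a, b) \<in> R \<Longrightarrow> (b, d) \<in> R \<Longrightarrow> (a, d) \<in> R"
  using equiv by (auto elim!: equivE dest: transD)

lemma class_eq: "(a, b) \<in> R \<Longrightarrow> R `` {a} = R `` {b}"
  by (rule equiv_class_eq[OF equiv])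

lemma class_eq_iff: "a \<in> P \<Longrightarrow> b \<in> P \<Longrightarrow> R `` {a} = R `` {b} \<longleftrightarrow> (a, b) \<in> R"
  by (rule eq_equiv_class_iff[OF equiv])

lemma obj_quotient: "obj quotient = Ob"
  by (simp add: quotient_def)

lemma arr_quotientI: "a \<in> P \<Longrightarrow> R `` {a} \<in> arr quotient"
  by (simp add: quotient_def quotientI)

lemma arr_quotientE:
  assumes "f \<in> arr quotient" obtains a where "a \<in> P" "f = R `` {a}"
  using assms by (auto simp: quotient_def elim: quotientE)

lemma src_quotient: "a \<in> P \<Longrightarrow> src quotient (R `` {a}) = s a"
  using s_cong R_refl by (auto simp: quotient_def intro!: the_equality)

lemma trg_quotient: "a \<in> P \<Longrightarrow> trg quotient (R `` {a}) = t a"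
  using t_cong R_refl by (auto simp: quotient_def intro!: the_equality)

text \<open>Congruence makes all classes in the family equal; the family is non-empty because
  \<open>a\<close> and \<open>b\<close> lie in their own classes and are composable.\<close>

lemma cmp_quotient:
  assumes "a \<in> P" "b \<in> P" "t a = s b"
  shows "cmp quotient (R `` {a}) (R `` {b}) = R `` {c a b}"
proof -
  have "R `` {c a' b'} = R `` {c a b}" if "(a, a') \<in> R" "(b, b') \<in> R" for a' b'
    using c_cong[OF that assms(3)] class_eq by blast
  then have "{R `` {c a' b'} | a' b'. a' \<in> R `` {a} \<and> b' \<in> R `` {b} \<and> t a' = s b'} = {R `` {c a b}}"
    using assms R_refl by blast
  then show ?thesis by (simp add: quotient_def)
qed

lemma ident_quotient: "ident quotient x = R `` {e x}"
  by (simp add: quotient_def)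

lemma inv_quotient:
  assumes "a \<in> P" shows "inv_arr quotient (R `` {a}) = R `` {v a}"
proof -
  have "\<Union>{R `` {v a'} | a'. a' \<in> R `` {a}} = R `` {v a}"
    using assms R_refl v_cong class_eq by (intro Union_constant_family) blast+
  then show ?thesis by (simp add: quotient_def)
qed

lemma groupoid_quotient: "groupoid quotient"
  by unfold_locales
    (auto elim!: arr_quotientE del: equalityI simp: obj_quotient src_quotient trg_quotient cmp_quotient
      ident_quotient inv_quotient c_in e_in v_in s_in t_in s_c t_c s_e t_e s_v t_v
      class_eq_iff c_assoc e_c c_e c_v v_c intro!: arr_quotientI)

end

text \<open>
  A relation pulled back along a map that is surjective up to equivalence and preserves all
  operations up to equivalence inherits the groupoid laws and has an isomorphic quotient.
\<close>

locale setoid_groupoid_pullback =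
  D: setoid_groupoid P' R' Ob s' t' c' e' v'
  for P' :: "'b set" and R' and Ob :: "'o set" and s' t' c' e' v' +
  fixes P :: "'a set" and R :: "('a \<times> 'a) set"
    and s t :: "'a \<Rightarrow> 'o" and c :: "'a \<Rightarrow> 'a \<Rightarrow> 'a" and e :: "'o \<Rightarrow> 'a" and v :: "'a \<Rightarrow> 'a"
    and \<Phi> :: "'a \<Rightarrow> 'b" and \<Psi> :: "'b \<Rightarrow> 'a"
  assumes R_iff: "(a, b) \<in> R \<longleftrightarrow> a \<in> P \<and> b \<in> P \<and> (\<Phi> a, \<Phi> b) \<in> R'"
    and \<Phi>_in: "a \<in> P \<Longrightarrow> \<Phi> a \<in> P'"
    and s_\<Phi>: "a \<in> P \<Longrightarrow> s a = s' (\<Phi> a)"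
    and t_\<Phi>: "a \<in> P \<Longrightarrow> t a = t' (\<Phi> a)"
    and c_in: "a \<in> P \<Longrightarrow> b \<in> P \<Longrightarrow> t a = s b \<Longrightarrow> c a b \<in> P"
    and c_\<Phi>: "a \<in> P \<Longrightarrow> b \<in> P \<Longrightarrow> t a = s b \<Longrightarrow> (\<Phi> (c a b), c' (\<Phi> a) (\<Phi> b)) \<in> R'"
    and e_in: "x \<in> Ob \<Longrightarrow> e x \<in> P"
    and e_\<Phi>: "x \<in> Ob \<Longrightarrow> (\<Phi> (e x), e' x) \<in> R'"
    and v_in: "a \<in> P \<Longrightarrow> v a \<in> P"
    and v_\<Phi>: "a \<in> P \<Longrightarrow> (\<Phi> (v a), v' (\<Phi> a)) \<in> R'"
    and \<Psi>_in: "u \<in> P' \<Longrightarrow> \<Psi> u \<in> P"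
    and \<Phi>_\<Psi>: "u \<in> P' \<Longrightarrow> (\<Phi> (\<Psi> u), u) \<in> R'"
begin

lemma s_via: "a \<in> P \<Longrightarrow> (\<Phi> a, u) \<in> R' \<Longrightarrow> s a = s' u"
  using s_\<Phi> D.s_cong by simp

lemma t_via: "a \<in> P \<Longrightarrow> (\<Phi> a, u) \<in> R' \<Longrightarrow> t a = t' u"
  using t_\<Phi> D.t_cong by simp

text \<open>This carries a law of \<open>P'\<close> over to \<open>P\<close>: \<open>u\<close> and
  \<open>w\<close> are the images of the two sides with \<Phi> pushed inside all operations, and the
  known law relates them.\<close>

lemma R_via: "a \<in> P \<Longrightarrow> b \<in> P \<Longrightarrow> (\<Phi> a, u) \<in> R' \<Longrightarrow> (\<Phi> b, w) \<in> R' \<Longrightarrow> (u, w) \<in> R' \<Longrightarrow> (a, b) \<in> R"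
  unfolding R_iff by (meson D.R_sym D.R_trans)

lemma c_via:
  assumes "a \<in> P" "b \<in> P" "t a = s b" "(\<Phi> a, u) \<in> R'" "(\<Phi> b, w) \<in> R'"
  shows "(\<Phi> (c a b), c' u w) \<in> R'"
proof -
  have "t' (\<Phi> a) = s' (\<Phi> b)" using assms s_\<Phi> t_\<Phi> by simp
  then show ?thesis using assms c_\<Phi> D.c_cong D.R_trans by blast
qed

lemma \<Phi>_refl: "a \<in> P \<Longrightarrow> (\<Phi> a, \<Phi> a) \<in> R'"
  using \<Phi>_in D.R_refl by blast

sublocale setoid_groupoid P R Ob s t c e v
proof
  show "equiv P R"
  proof (intro equivI refl_onI symI transI)
    show "R \<subseteq> P \<times> P" by (auto simp: R_iff)
  qed (use R_iff \<Phi>_refl D.R_sym D.R_trans in blast)+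
next
  fix a assume a: "a \<in> P"
  show "s a \<in> Ob" "t a \<in> Ob" using a s_\<Phi> t_\<Phi> \<Phi>_in D.s_in D.t_in by auto
  show "v a \<in> P" using a v_in by blast
  show sv: "s (v a) = t a" and tv: "t (v a) = s a"
    using a s_via[OF v_in v_\<Phi>] t_via[OF v_in v_\<Phi>] D.s_v D.t_v s_\<Phi> t_\<Phi> \<Phi>_in by auto
  have s: "s a \<in> Ob" "s' (\<Phi> a) = s a" and t: "t a \<in> Ob" "t' (\<Phi> a) = t a"
    using a s_\<Phi> t_\<Phi> \<Phi>_in D.s_in D.t_in by auto
  have es: "t (e (s a)) = s a" "s (e (t a)) = t a"
    using s t s_via[OF e_in e_\<Phi>] t_via[OF e_in e_\<Phi>] D.s_e D.t_e by auto
  show "(c (e (s a)) a, a) \<in> R"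
    using D.e_c[OF \<Phi>_in[OF a]] a s es
    by (intro R_via[OF _ _ c_via[OF _ _ _ e_\<Phi> \<Phi>_refl] \<Phi>_refl] c_in e_in) auto
  show "(c a (e (t a)), a) \<in> R"
    using D.c_e[OF \<Phi>_in[OF a]] a t es
    by (intro R_via[OF _ _ c_via[OF _ _ _ \<Phi>_refl e_\<Phi>] \<Phi>_refl] c_in e_in) auto
  show "(c a (v a), e (s a)) \<in> R"
    using D.c_v[OF \<Phi>_in[OF a]] a s sv
    by (intro R_via[OF _ _ c_via[OF _ _ _ \<Phi>_refl v_\<Phi>] e_\<Phi>] c_in e_in v_in) auto
  show "(c (v a) a, e (t a)) \<in> R"
    using D.v_c[OF \<Phi>_in[OF a]] a t tv
    by (intro R_via[OF _ _ c_via[OF _ _ _ v_\<Phi> \<Phi>_refl] e_\<Phi>] c_in e_in v_in) auto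
next
  fix a b assume ab: "(a, b) \<in> R"
  then show "s a = s b" "t a = t b" "(v a, v b) \<in> R"
    using s_\<Phi> t_\<Phi> D.s_cong D.t_cong D.v_cong v_in
    by (auto simp: R_iff intro: R_via[OF _ _ v_\<Phi> v_\<Phi>, unfolded R_iff, THEN conjunct2, THEN conjunct2])
next
  fix a b assume ab: "a \<in> P" "b \<in> P" "t a = s b"
  then show "c a b \<in> P" by (rule c_in)
  show "s (c a b) = s a" "t (c a b) = t b"
    using ab s_via[OF c_in c_\<Phi>, of a b] t_via[OF c_in c_\<Phi>, of a b] D.s_c[of "\<Phi> a" "\<Phi> b"]
      D.t_c[of "\<Phi> a" "\<Phi> b"] \<Phi>_in s_\<Phi> t_\<Phi> by auto
next
  fix a a' b b' assume R: "(a, a') \<in> R" "(b, b') \<in> R" and ab: "t a = s b"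
  \<comment> \<open>Composability is given only for \<open>a\<close> and \<open>b\<close>; for
    \<open>a'\<close> and \<open>b'\<close> it comes from the invariance of end points under
    \<open>R'\<close>.\<close>
  then have "t a' = s b'"
    using s_\<Phi> t_\<Phi> D.s_cong D.t_cong unfolding R_iff by metis
  with R ab have "(\<Phi> (c a b), c' (\<Phi> a) (\<Phi> b)) \<in> R'" "(\<Phi> (c a' b'), c' (\<Phi> a) (\<Phi> b)) \<in> R'"
      "c a b \<in> P" "c a' b' \<in> P"
    using c_\<Phi> c_in c_via D.R_sym by (auto simp: R_iff)
  then show "(c a b, c a' b') \<in> R"
    unfolding R_iff using D.R_sym D.R_trans by blast
next
  fix a b d assume abd: "a \<in> P" "b \<in> P" "d \<in> P" "t a = s b" "t b = s d"
  have "t (c a b) = s d" "s (c b d) = t a"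
    using abd s_via[OF c_in c_\<Phi>, of b d] t_via[OF c_in c_\<Phi>, of a b] D.s_c[of "\<Phi> b" "\<Phi> d"]
      D.t_c[of "\<Phi> a" "\<Phi> b"] \<Phi>_in s_\<Phi> t_\<Phi> by auto
  with abd show "(c (c a b) d, c a (c b d)) \<in> R"
    by (intro R_via[OF _ _ c_via[OF _ _ _ c_\<Phi> \<Phi>_refl] c_via[OF _ _ _ \<Phi>_refl c_\<Phi>]] c_in D.c_assoc)
      (auto simp: \<Phi>_in simp flip: s_\<Phi> t_\<Phi>)
next
  fix x assume "x \<in> Ob"
  then show "e x \<in> P" "s (e x) = x" "t (e x) = x"
    using e_in s_via[OF e_in e_\<Phi>] t_via[OF e_in e_\<Phi>] D.s_e D.t_e by auto
qed

text \<open>A union over all representatives avoids choosing one. With the hat construction for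
  \<Psi> this is the functor of the theorem.\<close>

definition lift_\<Psi> :: "'b set \<Rightarrow> 'a set" where
  "lift_\<Psi> \<beta> = \<Union>{R `` {\<Psi> u} | u. u \<in> \<beta>}"

definition lift_\<Phi> :: "'a set \<Rightarrow> 'b set" where
  "lift_\<Phi> \<alpha> = \<Union>{R' `` {\<Phi> a} | a. a \<in> \<alpha>}"

text \<open>Congruence of \<Psi> comes for free: \<open>R\<close> is detected on images under
  \<Phi>, and there \<Psi> is undone up to \<open>R'\<close>.\<close>

lemma \<Psi>_cong: "(u, w) \<in> R' \<Longrightarrow> (\<Psi> u, \<Psi> w) \<in> R"
  using D.R_in by (intro R_via[OF _ _ \<Phi>_\<Psi> \<Phi>_\<Psi>] \<Psi>_in) auto

lemma lift_\<Psi>_class: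
  assumes "u \<in> P'" shows "lift_\<Psi> (R' `` {u}) = R `` {\<Psi> u}"
proof -
  have "\<Union>{R `` {\<Psi> w} | w. w \<in> R' `` {u}} = R `` {\<Psi> u}"
    using assms D.R_refl \<Psi>_cong class_eq by (intro Union_constant_family) blast+
  then show ?thesis by (simp add: lift_\<Psi>_def)
qed

lemma lift_\<Phi>_class:
  assumes "a \<in> P" shows "lift_\<Phi> (R `` {a}) = R' `` {\<Phi> a}"
proof -
  have "R' `` {\<Phi> b} = R' `` {\<Phi> a}" if "(a, b) \<in> R" for b
    using that D.class_eq[of "\<Phi> a" "\<Phi> b"] by (simp add: R_iff)
  then have "\<Union>{R' `` {\<Phi> b} | b. b \<in> R `` {a}} = R' `` {\<Phi> a}"
    using assms R_refl by (intro Union_constant_family) blast+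
  then show ?thesis by (simp add: lift_\<Phi>_def)
qed

lemma functor_lift_\<Phi>: "groupoid_functor quotient D.quotient (\<lambda>x. x) lift_\<Phi>"
proof -
  interpret Q: groupoid quotient by (rule groupoid_quotient)
  interpret Q': groupoid D.quotient by (rule D.groupoid_quotient)
  show ?thesis
    by unfold_locales
      (auto elim!: arr_quotientE del: equalityI simp: obj_quotient D.obj_quotient src_quotient trg_quotient
        D.src_quotient D.trg_quotient lift_\<Phi>_class cmp_quotient D.cmp_quotient ident_quotient
        D.ident_quotient e_in c_in \<Phi>_in s_\<Phi> t_\<Phi>
        D.class_eq_iff D.c_in D.e_in e_\<Phi> c_\<Phi> intro!: D.arr_quotientI)
qed

lemma s_\<Psi>: "u \<in> P' \<Longrightarrow> s (\<Psi> u) = s' u"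
  using s_via \<Psi>_in \<Phi>_\<Psi> by blast

lemma t_\<Psi>: "u \<in> P' \<Longrightarrow> t (\<Psi> u) = t' u"
  using t_via \<Psi>_in \<Phi>_\<Psi> by blast

text \<open>The compatibility of \<Psi> with the operations is deduced from that of \<Phi>: the two
  sides of each equation have images under \<Phi> that are related in \<open>R'\<close>.\<close>

lemma functor_lift_\<Psi>: "groupoid_functor D.quotient quotient (\<lambda>x. x) lift_\<Psi>"
proof -
  interpret Q: groupoid quotient by (rule groupoid_quotient)
  interpret Q': groupoid D.quotient by (rule D.groupoid_quotient)
  have "(\<Psi> (e' x), e x) \<in> R" if "x \<in> Ob" for x
    using that by (intro R_via[OF _ _ \<Phi>_\<Psi> e_\<Phi>] \<Psi>_in D.e_in e_in D.R_refl)
  moreover have "(\<Psi> (c' u w), c (\<Psi> u) (\<Psi> w)) \<in> R" if "u \<in> P'" "w \<in> P'" "t' u = s' w" for u w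
    using that by (intro R_via[OF _ _ \<Phi>_\<Psi> c_via[OF _ _ _ \<Phi>_\<Psi> \<Phi>_\<Psi>]])
      (auto simp: s_\<Psi> t_\<Psi> \<Psi>_in c_in D.c_in D.R_refl)
  ultimately show ?thesis
    by unfold_locales
      (auto elim!: D.arr_quotientE del: equalityI simp: obj_quotient D.obj_quotient src_quotient trg_quotient
        D.src_quotient D.trg_quotient lift_\<Psi>_class cmp_quotient D.cmp_quotient ident_quotient
        D.ident_quotient D.e_in D.c_in \<Psi>_in s_\<Psi> t_\<Psi>
        class_eq_iff c_in e_in intro!: arr_quotientI)
qed

text \<open>One composite of the lifts is the identity by \<open>\<Phi>_\<Psi>\<close>, the other by
  \<open>\<Phi>_\<Psi>\<close> at \<open>\<Phi> a\<close> together with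
  \<open>R_iff\<close>.\<close>

lemma iso_lift_\<Psi>: "groupoid_iso D.quotient quotient (\<lambda>x. x) lift_\<Psi>"
proof -
  have "lift_\<Phi> (lift_\<Psi> f) = f" if "f \<in> arr D.quotient" for f
    using that
    by (auto elim!: D.arr_quotientE del: equalityI simp: lift_\<Psi>_class lift_\<Phi>_class \<Psi>_in \<Phi>_in
      D.class_eq_iff \<Phi>_\<Psi>)
  moreover have "lift_\<Psi> (lift_\<Phi> f) = f" if "f \<in> arr quotient" for f
    using that
    by (auto elim!: arr_quotientE del: equalityI simp: lift_\<Psi>_class lift_\<Phi>_class \<Phi>_in \<Psi>_in
      class_eq_iff R_iff \<Phi>_\<Psi>)
  ultimately show ?thesis
    unfolding groupoid_iso_def using functor_lift_\<Phi> functor_lift_\<Psi> by blast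
qed

end

section \<open>Edge paths\<close>

lemma edge_paths_iff:
  "a \<in> edge_paths X \<longleftrightarrow>
     a \<noteq> [] \<and> set a \<subseteq> points X \<and> successively (\<lambda>x y. {x, y} \<in> linked X) a"
  by (simp add: edge_paths_def successively_conv_nth)

lemma edge_path_nonempty: "a \<in> edge_paths X \<Longrightarrow> a \<noteq> []"
  by (simp add: edge_paths_iff)

lemma singleton_edge_path: "[x] \<in> edge_paths X \<longleftrightarrow> x \<in> points X"
  by (simp add: edge_paths_iff)

text \<open>The mirror image of the definition: the shared point is kept in \<open>b\<close>, so
  that \<open>b\<close> appears whole when the second argument varies.\<close>

lemma edge_concat_butlast:
  "a \<noteq> [] \<Longrightarrow> b \<noteq> [] \<Longrightarrow> last a = hd b \<Longrightarrow> edge_concat a b = butlast a @ b"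
  by (cases a rule: rev_cases; cases b) (auto simp: edge_concat_def)

lemma edge_concat_assoc: "b \<noteq> [] \<Longrightarrow> edge_concat (edge_concat a b) d = edge_concat a (edge_concat b d)"
  by (simp add: edge_concat_def)

lemma hd_edge_concat: "a \<noteq> [] \<Longrightarrow> hd (edge_concat a b) = hd a"
  by (simp add: edge_concat_def)

lemma last_edge_concat:
  "a \<noteq> [] \<Longrightarrow> b \<noteq> [] \<Longrightarrow> last a = hd b \<Longrightarrow> last (edge_concat a b) = last b"
  by (simp add: edge_concat_butlast)

lemma edge_equiv_equiv: "equiv (edge_paths X) (edge_equiv X)"
  by (intro equivI refl_onI symI transI)
    (auto simp: edge_equiv_def intro: equivclp_sym equivclp_trans)

lemma edge_equiv_sym: "(a, b) \<in> edge_equiv X \<Longrightarrow> (b, a) \<in> edge_equiv X"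
  by (auto simp: edge_equiv_def intro: equivclp_sym)

lemma edge_equiv_trans [trans]:
  "(a, b) \<in> edge_equiv X \<Longrightarrow> (b, d) \<in> edge_equiv X \<Longrightarrow> (a, d) \<in> edge_equiv X"
  by (auto simp: edge_equiv_def intro: equivclp_trans)

lemma edge_equiv_refl: "a \<in> edge_paths X \<Longrightarrow> (a, a) \<in> edge_equiv X"
  by (simp add: edge_equiv_def)

lemma edge_equiv_in: "(a, b) \<in> edge_equiv X \<Longrightarrow> a \<in> edge_paths X \<and> b \<in> edge_paths X"
  by (simp add: edge_equiv_def)

section \<open>Moves in context and the groupoid laws for edge paths\<close>

context simplicial_complex
begin

lemma linked_point: "S \<in> linked X \<Longrightarrow> x \<in> S \<Longrightarrow> x \<in> points X"
  using linked_subset by blast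

lemma linked_single_iff: "{x} \<in> linked X \<longleftrightarrow> x \<in> points X"
  using linked_singleton linked_subset by blast

text \<open>Since \<open>c\<close> ends in \<open>x\<close> and \<open>d\<close> begins with
  \<open>z\<close>, the concatenations amount to arbitrary, possibly empty contexts
  \<open>pre\<close> and \<open>post\<close>. In this form a move is visibly stable under extending
  the context.\<close>

lemma simple_step_iff:
  "simple_step X u w \<longleftrightarrow> u \<in> edge_paths X \<and>
     ((\<exists>pre x post. u = pre @ x # post \<and> w = pre @ x # x # post) \<or>
      (\<exists>pre x y z post. u = pre @ x # y # z # post \<and> w = pre @ x # z # post \<and> {x, y, z} \<in> linked X))"
  (is "_ \<longleftrightarrow> ?R")
proof
  assume "simple_step X u w"
  then show ?R
  proof cases
    case (repetition us x vs)
    then show ?thesis by auto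
  next
    case (triangle c d x z y)
    obtain pre where c: "c = pre @ [x]"
      using triangle by (cases c rule: rev_cases) (auto simp: edge_paths_iff)
    obtain post where d: "d = z # post"
      using triangle by (cases d) (auto simp: edge_paths_iff)
    have "{x, y} \<in> linked X" "{y, z} \<in> linked X" "y \<in> points X"
      using \<open>{x, y, z} \<in> linked X\<close> by (auto intro: linked_mono linked_point)
    then have "pre @ x # y # z # post \<in> edge_paths X"
      using triangle by (auto simp: c d edge_paths_iff successively_append_iff successively_Cons)
    then show ?thesis
      using triangle(1,2) \<open>{x, y, z} \<in> linked X\<close> by (auto simp: c d edge_concat_def)
  qed
next
  assume R: ?R
  then consider (repetition) pre x post where "u = pre @ x # post" "w = pre @ x # x # post"
    | (triangle) pre x y z post where "u = pre @ x # y # z # post" "w = pre @ x # z # post"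
      "{x, y, z} \<in> linked X"
    by blast
  then show "simple_step X u w"
  proof cases
    case repetition
    then show ?thesis using R simple_step.repetition[of pre x post X] by simp
  next
    case triangle
    then have "pre @ [x] \<in> edge_paths X" "z # post \<in> edge_paths X"
      using R by (auto simp: edge_paths_iff successively_append_iff successively_Cons)
    from simple_step.triangle[OF this _ _ triangle(3)] show ?thesis
      by (simp add: triangle(1,2) edge_concat_def)
  qed
qed

lemma simple_step_repeat:
  "pre @ x # post \<in> edge_paths X \<Longrightarrow> simple_step X (pre @ x # post) (pre @ x # x # post)"
  unfolding simple_step_iff by blast

lemma simple_step_triangle:
  "pre @ x # y # z # post \<in> edge_paths X \<Longrightarrow> {x, y, z} \<in> linked X \<Longrightarrow>
    simple_step X (pre @ x # y # z # post) (pre @ x # z # post)"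
  unfolding simple_step_iff by blast

lemma simple_step_cases [consumes 1, case_names repeat triangle]:
  assumes "simple_step X u w"
  obtains pre x post where "u = pre @ x # post" "w = pre @ x # x # post"
  | pre x y z post where "u = pre @ x # y # z # post" "w = pre @ x # z # post" "{x, y, z} \<in> linked X"
  using assms unfolding simple_step_iff by blast

lemma simple_step_in:
  assumes "simple_step X u w" shows "u \<in> edge_paths X" "w \<in> edge_paths X"
proof -
  show "u \<in> edge_paths X" using assms by (simp add: simple_step_iff)
  have "{x, z} \<in> linked X" if "{x, y, z} \<in> linked X" for x y z
    using that by (rule linked_mono) auto
  then show "w \<in> edge_paths X" using assms
    by (auto simp: simple_step_iff edge_paths_iff successively_append_iff successively_Cons
        linked_single_iff)
qed

lemma simple_step_ends:
  assumes "simple_step X u w" shows "hd u = hd w" "last u = last w"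
  using assms by (auto simp: simple_step_iff hd_append)

lemma simple_step_equiv: "simple_step X u w \<Longrightarrow> (u, w) \<in> edge_equiv X"
  by (auto simp: edge_equiv_def simple_step_in)

text \<open>A relation that is reflexive on edge paths, symmetric and transitive then needs checking
  on a single move only, in one direction.\<close>

lemma edge_equiv_induct [consumes 1, case_names refl sym trans step]:
  assumes "(a, b) \<in> edge_equiv X"
    and "\<And>a. a \<in> edge_paths X \<Longrightarrow> Q a a"
    and "\<And>a b. Q a b \<Longrightarrow> Q b a"
    and "\<And>a b c. Q a b \<Longrightarrow> Q b c \<Longrightarrow> Q a c"
    and "\<And>a b. simple_step X a b \<Longrightarrow> Q a b"
  shows "Q a b"
proof -
  have "equivclp (simple_step X) a b" "a \<in> edge_paths X"
    using assms(1) by (auto simp: edge_equiv_def)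
  then show ?thesis
    by (induction rule: equivclp_induct) (use assms(2-) in blast)+
qed

lemma edge_equiv_ends:
  assumes "(a, b) \<in> edge_equiv X" shows "hd a = hd b \<and> last a = last b"
  using assms by (induction rule: edge_equiv_induct) (auto dest: simple_step_ends)

text \<open>Both kinds of move are symmetric under reversal, as the set \<open>{x, y, z}\<close> has
  no order.\<close>

lemma edge_equiv_rev:
  assumes "(a, b) \<in> edge_equiv X" shows "(rev a, rev b) \<in> edge_equiv X"
  using assms
proof (induction rule: edge_equiv_induct)
  case (refl a)
  then show ?case
    by (intro edge_equiv_refl) (simp add: edge_paths_iff insert_commute)
next
  case (step a b)
  then have "rev a \<in> edge_paths X"
    using simple_step_in by (simp add: edge_paths_iff insert_commute)
  with step have "simple_step X (rev a) (rev b)"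
  proof (cases rule: simple_step_cases)
    case (repeat pre x post)
    then show ?thesis
      using \<open>rev a \<in> edge_paths X\<close> simple_step_repeat[of "rev post" x "rev pre"] by simp
  next
    case (triangle pre x y z post)
    then show ?thesis
      using \<open>rev a \<in> edge_paths X\<close> simple_step_triangle[of "rev post" z y x "rev pre"]
      by (simp add: insert_commute)
  qed
  then show ?case by (rule simple_step_equiv)
qed (auto intro: edge_equiv_sym edge_equiv_trans)

lemma edge_equiv_append:
  assumes "(a, b) \<in> edge_equiv X" "a @ w \<in> edge_paths X"
  shows "(a @ w, b @ w) \<in> edge_equiv X"
proof -
  \<comment> \<open>The induction has a symmetry case, so the claim is made symmetric in
    \<open>a\<close> and \<open>b\<close>. For a move the two hypotheses are equivalent, because the
    last point is unchanged.\<close>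
  have "(a @ w \<in> edge_paths X \<longrightarrow> (a @ w, b @ w) \<in> edge_equiv X) \<and>
      (b @ w \<in> edge_paths X \<longrightarrow> (b @ w, a @ w) \<in> edge_equiv X)"
    using assms(1)
  proof (induction rule: edge_equiv_induct)
    case (step a b)
    have "a @ w \<in> edge_paths X \<longleftrightarrow> b @ w \<in> edge_paths X"
      using simple_step_in[OF step] simple_step_ends[OF step]
      by (auto simp: edge_paths_iff successively_append_iff)
    moreover have "simple_step X (a @ w) (b @ w)" if "a @ w \<in> edge_paths X"
      using step
    proof (cases rule: simple_step_cases)
      case (repeat pre x post)
      then show ?thesis using that simple_step_repeat[of pre x "post @ w"] by simp
    next
      case (triangle pre x y z post)
      then show ?thesis using that simple_step_triangle[of pre x y z "post @ w"] by simp
    qed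
    ultimately show ?case using simple_step_equiv edge_equiv_sym by blast
  qed (auto intro: edge_equiv_refl edge_equiv_trans dest: edge_equiv_in)
  then show ?thesis using assms(2) by blast
qed

lemma rev_edge_paths: "a \<in> edge_paths X \<Longrightarrow> rev a \<in> edge_paths X"
  using edge_equiv_rev[OF edge_equiv_refl] edge_equiv_in by blast

lemma edge_equiv_prepend:
  assumes "(a, b) \<in> edge_equiv X" "w @ a \<in> edge_paths X"
  shows "(w @ a, w @ b) \<in> edge_equiv X"
  using edge_equiv_rev[OF edge_equiv_append[OF edge_equiv_rev[OF assms(1)], of "rev w"]]
    rev_edge_paths[OF assms(2)] by simp

lemma edge_concat_in:
  "a \<in> edge_paths X \<Longrightarrow> b \<in> edge_paths X \<Longrightarrow> last a = hd b \<Longrightarrow> edge_concat a b \<in> edge_paths X"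
  by (cases b; cases a rule: rev_cases)
    (auto simp: edge_concat_def edge_paths_iff successively_append_iff successively_Cons)

text \<open>One argument varies at a time. Reading the concatenation as \<open>a @ tl b\<close> and
  then as \<open>butlast a' @ b\<close> keeps the varying sequence whole, so the context lemmas
  apply.\<close>

lemma edge_concat_cong:
  assumes a: "(a, a') \<in> edge_equiv X" and b: "(b, b') \<in> edge_equiv X" and ends: "last a = hd b"
  shows "(edge_concat a b, edge_concat a' b') \<in> edge_equiv X"
proof -
  have in_paths: "a \<in> edge_paths X" "a' \<in> edge_paths X" "b \<in> edge_paths X" "b' \<in> edge_paths X"
    using a b edge_equiv_in by auto
  then have ne: "a \<noteq> []" "a' \<noteq> []" "b \<noteq> []" "b' \<noteq> []" by (auto simp: edge_paths_iff)
  have ends': "last a' = hd b" "last a' = hd b'"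
    using ends edge_equiv_ends[OF a] edge_equiv_ends[OF b] by auto
  have "(edge_concat a b, edge_concat a' b) \<in> edge_equiv X"
    using edge_equiv_append[OF a] edge_concat_in in_paths ends by (simp add: edge_concat_def)
  also have "(edge_concat a' b, edge_concat a' b') \<in> edge_equiv X"
    using edge_equiv_prepend[OF b] edge_concat_in[OF in_paths(2,3)] ne ends'
    by (simp add: edge_concat_butlast)
  finally show ?thesis .
qed

text \<open>Removing the first point leaves a shorter round trip, which contracts to
  \<open>[y]\<close>. What remains is \<open>[x, y, x]\<close>, a degenerate triangle since
  \<open>{x, y, x}\<close> is the linked pair \<open>{x, y}\<close>; it contracts to
  \<open>[x, x]\<close>, a repetition.\<close>

lemma edge_concat_rev:
  assumes "a \<in> edge_paths X" shows "(edge_concat a (rev a), [hd a]) \<in> edge_equiv X"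
  using assms
proof (induction a rule: induct_list012)
  case 1
  then show ?case by (simp add: edge_paths_iff)
next
  case (2 x)
  then show ?case by (simp add: edge_concat_def edge_equiv_refl)
next
  case (3 x y zs)
  let ?a = "y # zs"
  have xy: "{x, y} \<in> linked X" "x \<in> points X" "y \<in> points X" and a: "?a \<in> edge_paths X"
    using 3(3) by (auto simp: edge_paths_iff)
  have split: "edge_concat (x # ?a) (rev (x # ?a)) = [x] @ (edge_concat ?a (rev ?a) @ [x])"
    by (simp add: edge_concat_def tl_append split: list.split)
  have "(edge_concat ?a (rev ?a), [y]) \<in> edge_equiv X" using 3(2) a by simp
  moreover have "edge_concat (x # ?a) (rev (x # ?a)) \<in> edge_paths X"
    using 3(3) by (intro edge_concat_in rev_edge_paths) (auto simp: hd_rev)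
  then have in_paths: "[x] @ (edge_concat ?a (rev ?a) @ [x]) \<in> edge_paths X"
    unfolding split .
  moreover from this have "edge_concat ?a (rev ?a) @ [x] \<in> edge_paths X"
    by (auto simp: edge_paths_iff successively_Cons)
  ultimately have e1: "([x] @ (edge_concat ?a (rev ?a) @ [x]), [x] @ ([y] @ [x])) \<in> edge_equiv X"
    by (intro edge_equiv_prepend edge_equiv_append)
  have "simple_step X [x, y, x] [x, x]"
    using xy simple_step_triangle[of "[]" x y x "[]"] by (simp add: edge_paths_iff insert_commute)
  then have e2: "([x, y, x], [x, x]) \<in> edge_equiv X" by (rule simple_step_equiv)
  have "simple_step X [x] [x, x]"
    using xy simple_step_repeat[of "[]" x "[]"] by (simp add: edge_paths_iff)
  then have e3: "([x, x], [x]) \<in> edge_equiv X" by (rule edge_equiv_sym[OF simple_step_equiv])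
  show ?case
    unfolding split using edge_equiv_trans[OF e1 edge_equiv_trans[OF _ e3]] e2 by simp
qed

text \<open>Units and associativity hold as equalities of sequences; among the laws only those for
  inverses use moves.\<close>

lemma setoid_groupoid_edge:
  "setoid_groupoid (edge_paths X) (edge_equiv X) (points X) hd last edge_concat (\<lambda>x. [x]) rev"
proof
  fix a assume a: "a \<in> edge_paths X"
  then have ne: "a \<noteq> []" by (simp add: edge_paths_iff)
  show "hd a \<in> points X" "last a \<in> points X" using a by (auto simp: edge_paths_iff)
  show "(edge_concat [hd a] a, a) \<in> edge_equiv X" "(edge_concat a [last a], a) \<in> edge_equiv X"
    using a ne by (auto simp: edge_concat_def edge_equiv_refl)
  show "rev a \<in> edge_paths X" using a by (rule rev_edge_paths)
  show "hd (rev a) = last a" "last (rev a) = hd a" using ne by (auto simp: hd_rev last_rev)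
  show "(edge_concat a (rev a), [hd a]) \<in> edge_equiv X" using a by (rule edge_concat_rev)
  show "(edge_concat (rev a) a, [last a]) \<in> edge_equiv X"
    using edge_concat_rev[OF rev_edge_paths[OF a]] ne by (simp add: hd_rev)
qed (auto simp: edge_equiv_equiv edge_concat_in edge_concat_cong edge_equiv_rev edge_path_nonempty
    singleton_edge_path hd_edge_concat last_edge_concat edge_concat_assoc edge_equiv_refl
    dest: edge_equiv_ends)

end

section \<open>Paths\<close>

lemma path_support_le: "path_support a m p \<Longrightarrow> m \<le> p"
  by (simp add: path_support_def)

text \<open>The danger is that the supports are disjoint. Then the left half-line of one and the
  right half-line of the other cover the integers and overlap, which makes \<open>a\<close>
  constant.\<close>

lemma path_support_Int:
  assumes "path_support a m p" "path_support a m' p'" "\<nexists>x. \<forall>i. a i = x"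
  shows "path_support a (max m m') (min p p')"
proof -
  have overlap: "m \<le> p'" if "path_support a m p" "path_support a m' p'" for m p m' p'
  proof (rule ccontr)
    assume "\<not> m \<le> p'"
    have "a i = a m" for i
    proof (cases "i \<le> m")
      case True
      then show ?thesis using that(1) unfolding path_support_def by blast
    next
      case False
      then have "p' \<le> i" "p' \<le> m" using \<open>\<not> m \<le> p'\<close> by auto
      then have "a i = a p'" "a m = a p'" using that(2) unfolding path_support_def by blast+
      then show ?thesis by simp
    qed
    with assms(3) show False by blast
  qed
  have "m \<le> p'" "m' \<le> p" using overlap assms by blast+
  then have "max m m' \<le> min p p'" using assms(1,2)[THEN path_support_le] by simp
  moreover have "\<forall>i \<le> k. a i = a k" if "k = m \<or> k = m'" for k
    using that assms(1,2) unfolding path_support_def by blast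
  then have "\<forall>i \<le> max m m'. a i = a (max m m')" by (simp only: max_def split: if_split) blast
  moreover have "\<forall>i \<ge> k. a i = a k" if "k = p \<or> k = p'" for k
    using that assms(1,2) unfolding path_support_def by blast
  then have "\<forall>i \<ge> min p p'. a i = a (min p p')" by (simp only: min_def split: if_split) blast
  ultimately show ?thesis unfolding path_support_def by blast
qed

text \<open>The definite description needs a least support. A shortest support serves: its
  intersection with any other support is again a support, cannot be shorter, and so is all of
  it.\<close>

lemma path_support_std:
  assumes "path_support a m p"
  shows "path_support a (rho_minus a) (rho_plus a)"
proof (cases "\<exists>x. \<forall>i. a i = x")
  case True
  then show ?thesis
    by (auto simp: rho_minus_def rho_plus_def std_support_def path_support_def)
next
  case False
  let ?Q = "\<lambda>q. path_support a (fst q) (snd q)"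
  obtain q where q: "?Q q" and least: "\<And>q'. ?Q q' \<Longrightarrow> nat (snd q - fst q) \<le> nat (snd q' - fst q')"
    using ex_has_least_nat[of ?Q "(m, p)" "\<lambda>q. nat (snd q - fst q)"] assms by auto
  obtain k l where kl: "q = (k, l)" by (cases q)
  have sub: "{k..l} \<subseteq> {m'..p'}" if "path_support a m' p'" for m' p'
  proof -
    have "path_support a (max k m') (min l p')"
      using path_support_Int[OF _ that False] q kl by simp
    then have "max k m' \<le> min l p'" "nat (l - k) \<le> nat (min l p' - max k m')"
      using path_support_le[of a "max k m'" "min l p'"] least[of "(max k m', min l p')"] kl by auto
    then show ?thesis by auto
  qed
  have "std_support a = (THE (m, p). path_support a m p \<and>
      (\<forall>m' p'. path_support a m' p' \<longrightarrow> {m..p} \<subseteq> {m'..p'}))"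
    using False by (simp only: std_support_def if_False)
  also have "\<dots> = (k, l)"
  proof (rule the_equality)
    show "case (k, l) of (m, p) \<Rightarrow> path_support a m p \<and>
        (\<forall>m' p'. path_support a m' p' \<longrightarrow> {m..p} \<subseteq> {m'..p'})"
      using sub q kl by simp
  next
    fix r assume r: "case r of (m, p) \<Rightarrow> path_support a m p \<and>
        (\<forall>m' p'. path_support a m' p' \<longrightarrow> {m..p} \<subseteq> {m'..p'})"
    obtain m' p' where r': "r = (m', p')" by (cases r)
    have supports: "path_support a m' p'" "path_support a k l" using r r' q kl by auto
    then have "{m'..p'} \<subseteq> {k..l}" "{k..l} \<subseteq> {m'..p'}" using r r' sub by auto
    then show "r = (k, l)" using path_support_le[OF supports(1)] path_support_le[OF supports(2)] r' by auto
  qed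
  finally have "std_support a = (k, l)" .
  then show ?thesis using q kl by (simp add: rho_minus_def rho_plus_def)
qed

text \<open>With this, end points are read off from any convenient support and the least one never
  has to be computed.\<close>

lemma end_minus_eq:
  assumes "path_support a m p" shows "end_minus a = a m"
  using path_support_std[OF assms] assms linear[of "rho_minus a" m]
  unfolding path_support_def end_minus_def by metis

lemma end_plus_eq:
  assumes "path_support a m p" shows "end_plus a = a p"
  using path_support_std[OF assms] assms linear[of "rho_plus a" p]
  unfolding path_support_def end_plus_def by metis

lemma path_support_path: "a \<in> paths X \<Longrightarrow> path_support a (rho_minus a) (rho_plus a)"
  unfolding paths_def using path_support_std by blast

lemma rho_le: "a \<in> paths X \<Longrightarrow> rho_minus a \<le> rho_plus a"
  using path_support_path unfolding path_support_def by blast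

lemma path_left: "a \<in> paths X \<Longrightarrow> i \<le> rho_minus a \<Longrightarrow> a i = end_minus a"
  using path_support_path unfolding path_support_def end_minus_def by blast

lemma path_right: "a \<in> paths X \<Longrightarrow> rho_plus a \<le> i \<Longrightarrow> a i = end_plus a"
  using path_support_path unfolding path_support_def end_plus_def by blast

text \<open>The map \<Phi> of the transfer. For a constant path it gives one point, by the
  convention that its standard support is \<open>[0, 0]\<close>.\<close>

definition path_edges :: "(int \<Rightarrow> 'a) \<Rightarrow> 'a list" where
  "path_edges a = map a [rho_minus a..rho_plus a]"

lemma hd_map_upto: "m \<le> p \<Longrightarrow> hd (map a [m..p]) = a m"
  by (simp add: upto_rec1)

lemma last_map_upto: "m \<le> p \<Longrightarrow> last (map a [m..p]) = a p"
  by (simp add: upto_rec2)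

lemma map_upto_shift: "map (\<lambda>i. a (i - q)) [m + q..p + q] = map a [m..p]"
  by (rule nth_equalityI) (auto simp: algebra_simps)

lemma map_upto_uminus: "map (\<lambda>i. a (- i)) [- p..- m] = rev (map a [m..p])"
proof (rule nth_equalityI)
  fix i assume "i < length (map (\<lambda>i. a (- i)) [- p..- m])"
  then have "i < nat (p - m + 1)" "int (nat (p - m + 1) - Suc i) = p - m - int i"
    by (auto simp: of_nat_diff)
  then show "map (\<lambda>i. a (- i)) [- p..- m] ! i = rev (map a [m..p]) ! i"
    by (simp add: rev_nth)
qed simp

lemma linked_ladderD:
  assumes "\<And>i. {f i, f (i + 1), g i, g (i + 1)} \<in> linked X" "simplicial_complex X"
  shows "{f i, f (i + 1)} \<in> linked X" "{g i, g (i + 1)} \<in> linked X" "{f i, g i} \<in> linked X"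
  by (rule simplicial_complex.linked_mono[OF assms(2) assms(1)[of i]]; blast)+

section \<open>Linked cells of the line and the plane, and segments of paths\<close>

context simplicial_complex
begin

lemma scomplex_map_int_line: "scomplex_map int_line X a \<longleftrightarrow> (\<forall>i. {a i, a (i + 1)} \<in> linked X)"
proof
  assume "scomplex_map int_line X a"
  then have "a ` {i, i + 1} \<in> linked X" for i
    unfolding scomplex_map_def int_line_def by (auto simp del: image_insert)
  then show "\<forall>i. {a i, a (i + 1)} \<in> linked X" by simp
next
  assume link: "\<forall>i. {a i, a (i + 1)} \<in> linked X"
  then have "a i \<in> points X" for i using linked_point by blast
  then show "scomplex_map int_line X a"
    using link linked_empty linked_singleton unfolding scomplex_map_def int_line_def by auto
qed

text \<open>Each projection of a linked part lies in a pair of consecutive integers, so every linked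
  part of the plane is contained in a unit square, and unit squares are linked.\<close>

lemma scomplex_map_int_square:
  "scomplex_map (prod_scomplex int_line int_line) X A \<longleftrightarrow>
     (\<forall>i j. {A (i, j), A (i + 1, j), A (i, j + 1), A (i + 1, j + 1)} \<in> linked X)"
proof
  assume A: "scomplex_map (prod_scomplex int_line int_line) X A"
  show "\<forall>i j. {A (i, j), A (i + 1, j), A (i, j + 1), A (i + 1, j + 1)} \<in> linked X"
  proof (intro allI)
    fix i j :: int
    let ?S = "{(i, j), (i + 1, j), (i, j + 1), (i + 1, j + 1)}"
    have "fst ` ?S = {i, i + 1}" "snd ` ?S = {j, j + 1}" by auto
    then have "?S \<in> linked (prod_scomplex int_line int_line)"
      unfolding prod_scomplex_def int_line_def by simp blast
    then have "A ` ?S \<in> linked X" using A unfolding scomplex_map_def by blast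
    then show "{A (i, j), A (i + 1, j), A (i, j + 1), A (i + 1, j + 1)} \<in> linked X" by simp
  qed
next
  assume A: "\<forall>i j. {A (i, j), A (i + 1, j), A (i, j + 1), A (i + 1, j + 1)} \<in> linked X"
  have "A (i, j) \<in> points X" for i j
    using A[rule_format, of i j] by (rule linked_point) simp
  moreover have "A ` S \<in> linked X" if S: "S \<in> linked (prod_scomplex int_line int_line)" for S
  proof -
    have int_linked: "\<exists>i. T \<subseteq> {i, i + 1}" if "T \<in> linked int_line" for T
      using that unfolding int_line_def by auto
    obtain i j where "fst ` S \<subseteq> {i, i + 1}" "snd ` S \<subseteq> {j, j + 1}"
      using S int_linked[of "fst ` S"] int_linked[of "snd ` S"] by (auto simp: prod_scomplex_def)
    then have "S \<subseteq> {i, i + 1} \<times> {j, j + 1}" by force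
    then have "A ` S \<subseteq> {A (i, j), A (i + 1, j), A (i, j + 1), A (i + 1, j + 1)}" by auto
    then show ?thesis using A linked_mono by blast
  qed
  ultimately show "scomplex_map (prod_scomplex int_line int_line) X A"
    unfolding scomplex_map_def by (auto simp: prod_scomplex_def)
qed

lemma pathsI: "(\<And>i. {a i, a (i + 1)} \<in> linked X) \<Longrightarrow> path_support a m p \<Longrightarrow> a \<in> paths X"
  unfolding paths_def using scomplex_map_int_line by blast

lemma path_linked: "a \<in> paths X \<Longrightarrow> {a i, a (i + 1)} \<in> linked X"
  unfolding paths_def using scomplex_map_int_line by blast

lemma segment_in:
  assumes "\<And>i. {a i, a (i + 1)} \<in> linked X" "m \<le> p"
  shows "map a [m..p] \<in> edge_paths X"
proof -
  have "a i \<in> points X" for i using assms(1) linked_point by blast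
  moreover have "{a (m + int i), a (m + int (Suc i))} \<in> linked X" for i
    using assms(1)[of "m + int i"] by (simp add: algebra_simps)
  ultimately show ?thesis using assms(2) by (auto simp: edge_paths_def)
qed

text \<open>Outside its support a path only repeats an end value, so each additional place is one
  repetition move.\<close>

lemma segment_extend:
  assumes a: "a \<in> paths X" and support: "path_support a m p" and "m' \<le> m" "p \<le> p'"
  shows "(map a [m'..p'], map a [m..p]) \<in> edge_equiv X"
proof -
  have in_paths: "map a [k..l] \<in> edge_paths X" if "k \<le> l" for k l
    using path_linked[OF a] that by (intro segment_in)
  have "m \<le> p" and left: "\<And>i. i \<le> m \<Longrightarrow> a i = a m" and right: "\<And>i. p \<le> i \<Longrightarrow> a i = a p"
    using support unfolding path_support_def by blast+
  have "(map a [m'..p], map a [m..p]) \<in> edge_equiv X"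
    using \<open>m' \<le> m\<close>
  proof (induction rule: int_le_induct)
    case base
    show ?case using in_paths \<open>m \<le> p\<close> by (intro edge_equiv_refl)
  next
    case (step i)
    have "map a [i..p] = a i # map a [i + 1..p]" "map a [i - 1..p] = a i # a i # map a [i + 1..p]"
      using step(1) \<open>m \<le> p\<close> left[of i] left[of "i - 1"] by (simp_all add: upto_rec1)
    then have "(map a [i..p], map a [i - 1..p]) \<in> edge_equiv X"
      using simple_step_equiv[OF simple_step_repeat[of "[]" "a i" "map a [i + 1..p]"]] in_paths[of i p]
        step(1) \<open>m \<le> p\<close> by simp
    then show ?case using step edge_equiv_sym edge_equiv_trans by blast
  qed
  moreover have "(map a [m'..p'], map a [m'..p]) \<in> edge_equiv X"
    using \<open>p \<le> p'\<close>
  proof (induction rule: int_ge_induct)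
    case base
    show ?case using in_paths \<open>m \<le> p\<close> \<open>m' \<le> m\<close> by (intro edge_equiv_refl) auto
  next
    case (step i)
    have "map a [m'..i] = map a [m'..i - 1] @ [a i]"
      "map a [m'..i + 1] = map a [m'..i - 1] @ [a i, a i]"
      using step(1) \<open>m \<le> p\<close> \<open>m' \<le> m\<close> right[of i] right[of "i + 1"] by (simp_all add: upto_rec2)
    then have "(map a [m'..i], map a [m'..i + 1]) \<in> edge_equiv X"
      using simple_step_equiv[OF simple_step_repeat[of "map a [m'..i - 1]" "a i" "[]"]] in_paths[of m' i]
        step(1) \<open>m \<le> p\<close> \<open>m' \<le> m\<close> by simp
    then show ?case using step edge_equiv_sym edge_equiv_trans by blast
  qed
  ultimately show ?thesis by (rule edge_equiv_trans[rotated])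
qed

lemma path_edges_equiv:
  assumes "a \<in> paths X" "path_support a m p"
  shows "(path_edges a, map a [m..p]) \<in> edge_equiv X"
proof -
  \<comment> \<open>The two intervals need not be nested: for a constant path \<open>[0, 0]\<close>
    may lie outside \<open>[m, p]\<close>. Both are compared with an interval that contains
    them.\<close>
  let ?k = "min m (rho_minus a)" and ?l = "max p (rho_plus a)"
  have "(map a [?k..?l], path_edges a) \<in> edge_equiv X"
    unfolding path_edges_def using assms by (intro segment_extend path_support_path) auto
  moreover have "(map a [?k..?l], map a [m..p]) \<in> edge_equiv X"
    using assms by (intro segment_extend) auto
  ultimately show ?thesis using edge_equiv_sym edge_equiv_trans by blast
qed

lemma path_edges_in: "a \<in> paths X \<Longrightarrow> path_edges a \<in> edge_paths X"
  unfolding path_edges_def using path_linked rho_le by (intro segment_in) auto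

lemma hd_path_edges: "a \<in> paths X \<Longrightarrow> hd (path_edges a) = end_minus a"
  unfolding path_edges_def end_minus_def by (rule hd_map_upto[OF rho_le])

lemma last_path_edges: "a \<in> paths X \<Longrightarrow> last (path_edges a) = end_plus a"
  unfolding path_edges_def end_plus_def by (rule last_map_upto[OF rho_le])

lemma edge_paths_append:
  "a \<in> edge_paths X \<Longrightarrow> b \<in> edge_paths X \<Longrightarrow> {last a, hd b} \<in> linked X \<Longrightarrow> a @ b \<in> edge_paths X"
  by (auto simp: edge_paths_iff successively_append_iff)

section \<open>Homotopic paths have equivalent edge paths\<close>

lemma ladder_equiv:
  assumes link: "\<And>i. {f i, f (i + 1), g i, g (i + 1)} \<in> linked X"
  shows "(map f [k..k + int n] @ [g (k + int n)], f k # map g [k..k + int n]) \<in> edge_equiv X"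
\<comment> \<open>No agreement of \<open>f\<close> and \<open>g\<close> at the ends is assumed, so
  the induction hypothesis applies to the ladder without its last column; appending
  \<open>g (l + 1)\<close> to both sides leaves one square to cross.\<close>
proof (induction n)
  note linkD = linked_ladderD[of f g, OF link simplicial_complex_axioms]
  have path: "map f [k..l] @ map g [l..p] \<in> edge_paths X" if "k \<le> l" "l \<le> p" for k l p
    using that segment_in[of f] segment_in[of g] linkD
    by (intro edge_paths_append) (simp_all only: hd_map_upto last_map_upto)
  {
    case 0
    show ?case using path[of k k k] by (simp add: edge_equiv_refl)
  next
    case (Suc n)
    define l where "l = k + int n"
    have l: "k \<le> l" "k + int (Suc n) = l + 1" by (auto simp: l_def)
    have split: "map f [k..l] = map f [k..l - 1] @ [f l]" "map f [k..l + 1] = map f [k..l] @ [f (l + 1)]"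
      "map g [k..l + 1] = map g [k..l] @ [g (l + 1)]"
      using l by (simp_all add: upto_rec2)
    have short: "map g [l..l + 1] = [g l, g (l + 1)]" "map g [l + 1..l + 1] = [g (l + 1)]"
      by (simp_all add: upto_rec1)
    have "map f [k..l] @ [g l, g (l + 1)] \<in> edge_paths X"
      "map f [k..l] @ [f (l + 1), g (l + 1)] \<in> edge_paths X"
      using path[of k l "l + 1"] path[of k "l + 1" "l + 1"] l by (simp_all add: short split(2) del: upto_single)
    \<comment> \<open>The square is cut along the diagonal from \<open>f l\<close> to
      \<open>g (l + 1)\<close>. Both halves are linked, and both ways around contract to that
      diagonal.\<close>
    moreover have "{f l, f (l + 1), g (l + 1)} \<in> linked X" "{f l, g l, g (l + 1)} \<in> linked X"
      by (rule linked_mono[OF link[of l]]; blast)+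
    ultimately have
      "(map f [k..l] @ [f (l + 1), g (l + 1)], map f [k..l] @ [g (l + 1)]) \<in> edge_equiv X"
      "(map f [k..l] @ [g l, g (l + 1)], map f [k..l] @ [g (l + 1)]) \<in> edge_equiv X"
      using simple_step_equiv[OF simple_step_triangle[of "map f [k..l - 1]" "f l" _ "g (l + 1)" "[]"]]
      by (simp_all add: split(1))
    moreover have "((map f [k..l] @ [g l]) @ [g (l + 1)], (f k # map g [k..l]) @ [g (l + 1)]) \<in> edge_equiv X"
      using Suc \<open>map f [k..l] @ [g l, g (l + 1)] \<in> edge_paths X\<close>
      by (intro edge_equiv_append) (simp_all add: l_def)
    then have "(map f [k..l] @ [g l, g (l + 1)], f k # map g [k..l] @ [g (l + 1)]) \<in> edge_equiv X"
      by simp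
    ultimately have
      "(map f [k..l] @ [f (l + 1), g (l + 1)], f k # map g [k..l] @ [g (l + 1)]) \<in> edge_equiv X"
      using edge_equiv_sym edge_equiv_trans by blast
    then show ?case by (simp only: l split append_assoc append_Cons append_Nil)
  }
qed

text \<open>Where the rows agree at both ends, the extra last point \<open>g p\<close> and the extra
  first point \<open>f m\<close> of the ladder are mere repetitions.\<close>

lemma adjacent_segments_equiv:
  assumes link: "\<And>i. {f i, f (i + 1), g i, g (i + 1)} \<in> linked X"
    and "m \<le> p" "f m = g m" "f p = g p"
  shows "(map f [m..p], map g [m..p]) \<in> edge_equiv X"
proof -
  note linkD = linked_ladderD[of f g, OF link simplicial_complex_axioms]
  have in_paths: "map f [m..p] \<in> edge_paths X" "map g [m..p] \<in> edge_paths X"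
    using linkD \<open>m \<le> p\<close> by (auto intro!: segment_in)
  have split: "map f [m..p] = map f [m..p - 1] @ [f p]"
    using \<open>m \<le> p\<close> by (simp add: upto_rec2)
  have split': "map g [m..p] = g m # map g [m + 1..p]"
    using \<open>m \<le> p\<close> by (simp add: upto_rec1)
  have s1: "simple_step X (map f [m..p]) (map f [m..p] @ [g p])"
    using simple_step_repeat[of "map f [m..p - 1]" "f p" "[]"] in_paths(1) \<open>f p = g p\<close>
    by (simp add: split)
  have s2: "simple_step X (map g [m..p]) (f m # map g [m..p])"
    using simple_step_repeat[of "[]" "g m" "map g [m + 1..p]"] in_paths(2) \<open>f m = g m\<close>
    by (simp add: split')
  have "(map f [m..p] @ [g p], f m # map g [m..p]) \<in> edge_equiv X"
    using ladder_equiv[of f g m "nat (p - m)", OF link] \<open>m \<le> p\<close> by simp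
  from edge_equiv_trans[OF simple_step_equiv[OF s1] edge_equiv_trans[OF this
        edge_equiv_sym[OF simple_step_equiv[OF s2]]]]
  show ?thesis .
qed

lemma homotopic2_iff:
  "(a, b) \<in> homotopic2 X \<longleftrightarrow>
     a \<in> paths X \<and> b \<in> paths X \<and> end_minus b = end_minus a \<and> end_plus b = end_plus a \<and>
     (\<exists>(A :: int \<times> int \<Rightarrow> 'a) (rm :: int) (rp :: int) (sm :: int) (sp :: int).
        (\<forall>i j. {A (i, j), A (i + 1, j), A (i, j + 1), A (i + 1, j + 1)} \<in> linked X) \<and>
        rm \<le> rp \<and> sm \<le> sp \<and>
        (\<forall>i j. i \<le> rm \<longrightarrow> A (i, j) = end_minus a) \<and> (\<forall>i j. rp \<le> i \<longrightarrow> A (i, j) = end_plus a) \<and>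
        (\<forall>i j. j \<le> sm \<longrightarrow> A (i, j) = a i) \<and> (\<forall>i j. sp \<le> j \<longrightarrow> A (i, j) = b i))"
  by (simp add: homotopic2_def scomplex_map_int_square)

lemma homotopic2_imp_edge_equiv:
  assumes "(a, b) \<in> homotopic2 X"
  shows "(path_edges a, path_edges b) \<in> edge_equiv X"
proof -
  obtain A :: "int \<times> int \<Rightarrow> 'a" and rm rp sm sp :: int where ab: "a \<in> paths X" "b \<in> paths X"
    and A: "\<And>i j. {A (i, j), A (i + 1, j), A (i, j + 1), A (i + 1, j + 1)} \<in> linked X"
    and "rm \<le> rp" "sm \<le> sp"
    and left: "\<And>i j. i \<le> rm \<Longrightarrow> A (i, j) = end_minus a"
    and right: "\<And>i j. rp \<le> i \<Longrightarrow> A (i, j) = end_plus a"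
    and lower: "\<And>i j. j \<le> sm \<Longrightarrow> A (i, j) = a i"
    and upper: "\<And>i j. sp \<le> j \<Longrightarrow> A (i, j) = b i"
    using assms[unfolded homotopic2_iff] by blast
  \<comment> \<open>The interval from \<open>m\<close> to \<open>p\<close> contains both standard
    supports, and its ends lie where the homotopy is constant, so all rows agree at \<open>m\<close>
    and at \<open>p\<close>.\<close>
  define m where "m = min rm (min (rho_minus a) (rho_minus b))"
  define p where "p = max rp (max (rho_plus a) (rho_plus b))"
  have mp: "m \<le> rm" "m \<le> rho_minus a" "m \<le> rho_minus b" "rp \<le> p" "rho_plus a \<le> p" "rho_plus b \<le> p"
    "m \<le> p"
    using \<open>rm \<le> rp\<close> by (auto simp: m_def p_def)
  have row: "{A (i, j), A (i + 1, j)} \<in> linked X" for i j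
    by (rule linked_mono[OF A[of i j]]) auto
  have "(map (\<lambda>i. A (i, sm)) [m..p], map (\<lambda>i. A (i, sp)) [m..p]) \<in> edge_equiv X"
    using \<open>sm \<le> sp\<close>
  proof (induction rule: int_ge_induct)
    case base
    show ?case using row mp by (intro edge_equiv_refl segment_in)
  next
    case (step j)
    have "(map (\<lambda>i. A (i, j)) [m..p], map (\<lambda>i. A (i, j + 1)) [m..p]) \<in> edge_equiv X"
      using A mp left right by (intro adjacent_segments_equiv) auto
    with step show ?case using edge_equiv_trans by blast
  qed
  then have "(map a [m..p], map b [m..p]) \<in> edge_equiv X"
    using lower upper by simp
  moreover have "(map a [m..p], path_edges a) \<in> edge_equiv X" "(map b [m..p], path_edges b) \<in> edge_equiv X"
    unfolding path_edges_def using ab mp by (auto intro!: segment_extend path_support_path)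
  ultimately show ?thesis using edge_equiv_sym edge_equiv_trans by blast
qed

end

section \<open>Homotopies between paths\<close>

text \<open>For \<open>n\<close> at or left of the standard support this is translation by one
  place, for \<open>n\<close> at or right of its end the path itself; the values of \<open>n\<close>
  between interpolate.\<close>

definition delay :: "int \<Rightarrow> (int \<Rightarrow> 'a) \<Rightarrow> (int \<Rightarrow> 'a)" where
  "delay n a = (\<lambda>i. if i \<le> n then a i else a (i - 1))"

section \<open>Values and supports of hats, delays, concatenations and reverses\<close>

lemma edge_path_hat_outer:
  "i \<le> 0 \<Longrightarrow> edge_path_hat u i = u ! 0"
  "int (length u - 1) \<le> i \<Longrightarrow> edge_path_hat u i = u ! (length u - 1)"
  by (simp_all add: edge_path_hat_def)

lemma edge_path_hat_inner: "n < length u \<Longrightarrow> edge_path_hat u (int n) = u ! n"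
  by (simp add: edge_path_hat_def)

lemma path_support_hat: "path_support (edge_path_hat u) 0 (int (length u - 1))"
  unfolding path_support_def using edge_path_hat_outer[where u = u] by simp

lemma edge_path_hat_ends:
  "end_minus (edge_path_hat u) = u ! 0" "end_plus (edge_path_hat u) = u ! (length u - 1)"
  by (simp_all add: end_minus_eq[OF path_support_hat] end_plus_eq[OF path_support_hat]
      edge_path_hat_outer)

lemma segment_hat: "u \<noteq> [] \<Longrightarrow> map (edge_path_hat u) [0..int (length u - 1)] = u"
  by (rule nth_equalityI; cases u) (auto simp: edge_path_hat_inner nat_add_distrib)

text \<open>Clamping the index to the segment changes nothing, as the path is constant beyond it;
  only the shift of the origin to \<open>m\<close> remains.\<close>

lemma edge_path_hat_segment:
  assumes "path_support a m p"
  shows "edge_path_hat (map a [m..p]) = (\<lambda>i. a (i + m))"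
proof
  fix i
  have "m \<le> p" and left: "\<And>i. i \<le> m \<Longrightarrow> a i = a m" and right: "\<And>i. p \<le> i \<Longrightarrow> a i = a p"
    using assms unfolding path_support_def by blast+
  then have len: "int (length (map a [m..p]) - 1) = p - m" by simp
  consider "i < 0" | "0 \<le> i" "i \<le> p - m" | "p - m < i" by linarith
  then show "edge_path_hat (map a [m..p]) i = a (i + m)"
    unfolding edge_path_hat_def len
    using \<open>m \<le> p\<close> left[of "i + m"] right[of "i + m"]
    by cases (simp_all add: add.commute)
qed

lemma edge_path_hat_repeat:
  "edge_path_hat (pre @ x # x # post) = delay (int (length pre)) (edge_path_hat (pre @ x # post))"
proof
  fix i
  show "edge_path_hat (pre @ x # x # post) i = delay (int (length pre)) (edge_path_hat (pre @ x # post)) i"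
  proof (cases "i \<le> int (length pre)")
    case True
    then show ?thesis by (auto simp: edge_path_hat_def delay_def nth_append min_def max_def)
  next
    case False
    \<comment> \<open>\<open>k\<close> counts the places beyond the second copy of \<open>x\<close>.
      Both clamped indices stop moving at \<open>k = length post\<close> and always differ by
      one.\<close>
    define k where "k = nat (i - int (length pre) - 1)"
    have i: "i = int (length pre) + 1 + int k" using False by (simp add: k_def)
    have "nat (min (max 0 i) (int (length (pre @ x # x # post) - 1))) = length pre + Suc (min k (length post))"
      "nat (min (max 0 (i - 1)) (int (length (pre @ x # post) - 1))) = length pre + min k (length post)"
      by (auto simp: i min_def)
    then show ?thesis using False by (simp add: edge_path_hat_def delay_def nth_append)
  qed
qed

text \<open>The contexts are non-empty because an end point of the sequence is taken on a whole
  half-line, where replacing it would change infinitely many values.\<close>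

lemma edge_path_hat_replace:
  "edge_path_hat (pre @ y # post) = (edge_path_hat (pre @ x # post))(int (length pre) := y)"
  if "pre \<noteq> []" "post \<noteq> []"
  using that by (cases post) (auto simp: edge_path_hat_def fun_eq_iff nth_append nth_Cons' min_def max_def)

lemma path_support_delay:
  assumes "path_support a m p" shows "path_support (delay n a) m (p + 1)"
proof -
  have "m \<le> p" and left: "\<And>i. i \<le> m \<Longrightarrow> a i = a m" and right: "\<And>i. p \<le> i \<Longrightarrow> a i = a p"
    using assms unfolding path_support_def by blast+
  have "delay n a i = a m" if "i \<le> m" for i
    using that left[of i] left[of "i - 1"] by (simp add: delay_def)
  moreover have "delay n a i = a p" if "p + 1 \<le> i" for i
    using that right[of i] right[of "i - 1"] by (simp add: delay_def)
  ultimately show ?thesis using \<open>m \<le> p\<close> by (simp add: path_support_def)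
qed

text \<open>\<open>m\<close> and \<open>l\<close> belong to arbitrary supports, but \<open>p\<close>
  and \<open>k\<close> are standard, since \<open>path_concat\<close> puts its seam at
  \<open>p + k\<close>.\<close>

lemma path_support_concat:
  assumes "path_support a m p" "path_support b k l" "p = rho_plus a" "k = rho_minus b" "a p = b k"
  shows "path_support (path_concat a b) (m + k) (l + p)"
    "map (path_concat a b) [m + k..l + p] = edge_concat (map a [m..p]) (map b [k..l])"
proof -
  have le: "m \<le> p" "k \<le> l" and left: "\<And>i. i \<le> m \<Longrightarrow> a i = a m" and right: "\<And>i. l \<le> i \<Longrightarrow> b i = b l"
    using assms unfolding path_support_def by blast+
  have A: "path_concat a b i = a (i - k)" if "i \<le> p + k" for i
    using that by (simp add: path_concat_def flip: assms(3,4))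
  have B: "path_concat a b i = b (i - p)" if "k + p \<le> i" for i
    using that assms(5)
    by (cases "i = p + k") (auto simp: path_concat_def simp flip: assms(3,4))
  have "path_concat a b i = a m" if "i \<le> m + k" for i
    using that A[of i] le left[of "i - k"] by simp
  moreover have "path_concat a b i = b l" if "l + p \<le> i" for i
    using that B[of i] le right[of "i - p"] by simp
  ultimately show "path_support (path_concat a b) (m + k) (l + p)"
    using le by (simp add: path_support_def)
  have "map (path_concat a b) [m + k..p + k] = map (\<lambda>i. a (i - k)) [m + k..p + k]"
    using A by simp
  then have 1: "map (path_concat a b) [m + k..p + k] = map a [m..p]"
    by (simp only: map_upto_shift)
  have "map (path_concat a b) [k + 1 + p..l + p] = map (\<lambda>i. b (i - p)) [k + 1 + p..l + p]"
    using B by simp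
  then have 2: "map (path_concat a b) [k + 1 + p..l + p] = map b [k + 1..l]"
    by (simp only: map_upto_shift)
  \<comment> \<open>The seam \<open>p + k\<close> goes to the first part; the second starts one
    place later and so omits \<open>b k\<close>, just as \<open>edge_concat\<close> drops the
    head.\<close>
  have "[m + k..l + p] = [m + k..p + k] @ [k + 1 + p..l + p]"
    using upto_split2[of "m + k" "p + k" "l + p"] le by (simp add: algebra_simps)
  moreover have "map b [k..l] = b k # map b [k + 1..l]" using le by (simp add: upto_rec1)
  ultimately show "map (path_concat a b) [m + k..l + p] = edge_concat (map a [m..p]) (map b [k..l])"
    using 1 2 by (simp only: edge_concat_def map_append list.sel)
qed

lemma path_support_reverse:
  assumes "path_support a m p" shows "path_support (path_reverse a) (- p) (- m)"
proof -
  have "m \<le> p" and left: "\<And>i. i \<le> m \<Longrightarrow> a i = a m" and right: "\<And>i. p \<le> i \<Longrightarrow> a i = a p"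
    using assms unfolding path_support_def by blast+
  have "path_reverse a i = a p" if "i \<le> - p" for i
    using that right[of "- i"] by (simp add: path_reverse_def)
  moreover have "path_reverse a i = a m" if "- m \<le> i" for i
    using that left[of "- i"] by (simp add: path_reverse_def)
  ultimately show ?thesis using \<open>m \<le> p\<close> by (simp add: path_support_def)
qed

section \<open>Homotopy as an equivalence relation, and one-step homotopies\<close>

context simplicial_complex
begin

lemma homotopic2I:
  fixes A :: "int \<times> int \<Rightarrow> 'a" and rm rp sm sp :: int
  assumes "a \<in> paths X" "b \<in> paths X" "end_minus b = end_minus a" "end_plus b = end_plus a"
    and "\<And>i j. {A (i, j), A (i + 1, j), A (i, j + 1), A (i + 1, j + 1)} \<in> linked X"
    and "rm \<le> rp" "sm \<le> sp"
    and "\<And>i j. i \<le> rm \<Longrightarrow> A (i, j) = end_minus a" "\<And>i j. rp \<le> i \<Longrightarrow> A (i, j) = end_plus a"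
    and "\<And>i j. j \<le> sm \<Longrightarrow> A (i, j) = a i" "\<And>i j. sp \<le> j \<Longrightarrow> A (i, j) = b i"
  shows "(a, b) \<in> homotopic2 X"
  unfolding homotopic2_iff
  by (intro conjI assms(1-4), rule exI[of _ A], rule exI[of _ rm], rule exI[of _ rp],
      rule exI[of _ sm], rule exI[of _ sp]) (simp add: assms)

lemma homotopic2_refl:
  assumes "a \<in> paths X" shows "(a, a) \<in> homotopic2 X"
proof -
  have "{a i, a (i + 1), a i, a (i + 1)} \<in> linked X" for i
    using path_linked[OF assms, of i] by (rule linked_mono) auto
  then show ?thesis
    using assms rho_le[OF assms] path_left[OF assms] path_right[OF assms]
    by (intro homotopic2I[where A = "\<lambda>(i, j). a i" and rm = "rho_minus a" and rp = "rho_plus a"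
          and sm = 0 and sp = 0]) auto
qed

lemma homotopic2_sym:
  assumes "(a, b) \<in> homotopic2 X" shows "(b, a) \<in> homotopic2 X"
proof -
  obtain A :: "int \<times> int \<Rightarrow> 'a" and rm rp sm sp :: int where ab: "a \<in> paths X" "b \<in> paths X"
    "end_minus b = end_minus a" "end_plus b = end_plus a"
    and A: "\<And>i j. {A (i, j), A (i + 1, j), A (i, j + 1), A (i + 1, j + 1)} \<in> linked X"
    and A': "rm \<le> rp" "sm \<le> sp"
      "\<And>i j. i \<le> rm \<Longrightarrow> A (i, j) = end_minus a" "\<And>i j. rp \<le> i \<Longrightarrow> A (i, j) = end_plus a"
      "\<And>i j. j \<le> sm \<Longrightarrow> A (i, j) = a i" "\<And>i j. sp \<le> j \<Longrightarrow> A (i, j) = b i"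
    using assms[unfolded homotopic2_iff] by blast
  have "{A (i, - j), A (i + 1, - j), A (i, - (j + 1)), A (i + 1, - (j + 1))} \<in> linked X" for i j
    using A[of i "- (j + 1)"] by (rule linked_mono) auto
  then show ?thesis
    using ab A'
    by (intro homotopic2I[where A = "\<lambda>(i, j). A (i, - j)" and rm = rm and rp = rp
          and sm = "- sp" and sp = "- sm"]) auto
qed

lemma homotopic2_trans:
  assumes "(a, b) \<in> homotopic2 X" "(b, d) \<in> homotopic2 X" shows "(a, d) \<in> homotopic2 X"
proof -
  obtain A :: "int \<times> int \<Rightarrow> 'a" and rm rp sm sp :: int where ab: "a \<in> paths X" "b \<in> paths X"
    "end_minus b = end_minus a" "end_plus b = end_plus a"
    and A: "\<And>i j. {A (i, j), A (i + 1, j), A (i, j + 1), A (i + 1, j + 1)} \<in> linked X"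
    and "rm \<le> rp" "sm \<le> sp" and A':
      "\<And>i j. i \<le> rm \<Longrightarrow> A (i, j) = end_minus a" "\<And>i j. rp \<le> i \<Longrightarrow> A (i, j) = end_plus a"
      "\<And>i j. j \<le> sm \<Longrightarrow> A (i, j) = a i" "\<And>i j. sp \<le> j \<Longrightarrow> A (i, j) = b i"
    using assms(1)[unfolded homotopic2_iff] by blast
  obtain B :: "int \<times> int \<Rightarrow> 'a" and rm' rp' sm' sp' :: int where bd: "d \<in> paths X"
    "end_minus d = end_minus b" "end_plus d = end_plus b"
    and B: "\<And>i j. {B (i, j), B (i + 1, j), B (i, j + 1), B (i + 1, j + 1)} \<in> linked X"
    and "rm' \<le> rp'" "sm' \<le> sp'" and B':
      "\<And>i j. i \<le> rm' \<Longrightarrow> B (i, j) = end_minus b" "\<And>i j. rp' \<le> i \<Longrightarrow> B (i, j) = end_plus b"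
      "\<And>i j. j \<le> sm' \<Longrightarrow> B (i, j) = b i" "\<And>i j. sp' \<le> j \<Longrightarrow> B (i, j) = d i"
    using assms(2)[unfolded homotopic2_iff] by blast
  \<comment> \<open>\<open>B\<close> is moved vertically so that its row \<open>sm'\<close> lands on
    row \<open>sp\<close> of \<open>A\<close>. Both rows are \<open>b\<close>, so every unit square
    of \<open>C\<close> lies entirely in one of the two homotopies.\<close>
  define C where "C = (\<lambda>(i, j). if j \<le> sp then A (i, j) else B (i, j - sp + sm'))"
  have C_A: "C (i, j) = A (i, j)" if "j \<le> sp" for i j
    using that by (simp add: C_def)
  have C_B: "C (i, j) = B (i, j - sp + sm')" if "sp \<le> j" for i j
    using that A'(4)[of j i] B'(3)[of "j - sp + sm'" i] by (auto simp: C_def)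
  have "{C (i, j), C (i + 1, j), C (i, j + 1), C (i + 1, j + 1)} \<in> linked X" for i j
  proof (cases "j + 1 \<le> sp")
    case True
    then show ?thesis using A[of i j] by (simp add: C_A)
  next
    case False
    then show ?thesis using B[of i "j - sp + sm'"] by (simp add: C_B algebra_simps)
  qed
  moreover have "C (i, j) = end_minus a" if "i \<le> min rm rm'" for i j
    using that A'(1) B'(1) ab by (simp add: C_def)
  moreover have "C (i, j) = end_plus a" if "max rp rp' \<le> i" for i j
    using that A'(2) B'(2) ab by (simp add: C_def)
  moreover have "C (i, j) = a i" if "j \<le> sm" for i j
    using that A'(3) \<open>sm \<le> sp\<close> by (simp add: C_A)
  moreover have "C (i, j) = d i" if "sp + sp' - sm' \<le> j" for i j
    using that B'(4) \<open>sm' \<le> sp'\<close> by (simp add: C_B)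
  moreover have "min rm rm' \<le> max rp rp'" "sm \<le> sp + sp' - sm'"
    using \<open>rm \<le> rp\<close> \<open>sm \<le> sp\<close> \<open>sm' \<le> sp'\<close> by auto
  ultimately show ?thesis
    using ab bd
    by (intro homotopic2I[where A = C and rm = "min rm rm'" and rp = "max rp rp'"
          and sm = sm and sp = "sp + sp' - sm'"]) simp_all
qed

text \<open>A homotopy that changes rows only between heights 0 and 1: the squares across the change
  are linked by assumption, all others repeat one row. The homotopies below are composed of
  these.\<close>

lemma homotopic2_adjacent:
  assumes a: "a \<in> paths X" and b: "b \<in> paths X"
    and ends: "end_minus b = end_minus a" "end_plus b = end_plus a"
    and link: "\<And>i. {a i, a (i + 1), b i, b (i + 1)} \<in> linked X"
  shows "(a, b) \<in> homotopic2 X"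
proof -
  let ?A = "\<lambda>(i, j). if j \<le> (0 :: int) then a i else b i"
  have "{?A (i, j), ?A (i + 1, j), ?A (i, j + 1), ?A (i + 1, j + 1)} \<in> linked X" for i j
    using link[of i] by (rule linked_mono) auto
  moreover have "?A (i, j) = end_minus a" if "i \<le> min (rho_minus a) (rho_minus b)" for i j
    using that ends path_left[OF a] path_left[OF b] by auto
  moreover have "?A (i, j) = end_plus a" if "max (rho_plus a) (rho_plus b) \<le> i" for i j
    using that ends path_right[OF a] path_right[OF b] by auto
  moreover have "min (rho_minus a) (rho_minus b) \<le> max (rho_plus a) (rho_plus b)"
    using rho_le[OF a] by auto
  ultimately show ?thesis
    using a b ends
    by (intro homotopic2I[where A = ?A and rm = "min (rho_minus a) (rho_minus b)"
          and rp = "max (rho_plus a) (rho_plus b)" and sm = 0 and sp = 1]) simp_all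
qed

section \<open>Delays and translations\<close>

lemma delay_in:
  assumes "a \<in> paths X" shows "delay n a \<in> paths X"
proof (rule pathsI)
  show "path_support (delay n a) (rho_minus a) (rho_plus a + 1)"
    using path_support_path[OF assms] by (rule path_support_delay)
  show "{delay n a i, delay n a (i + 1)} \<in> linked X" for i
    using path_linked[OF assms, of "if i \<le> n then i else i - 1"]
    by (rule linked_mono) (auto simp: delay_def)
qed

lemma delay_ends:
  assumes "a \<in> paths X"
  shows "end_minus (delay n a) = end_minus a" "end_plus (delay n a) = end_plus a"
proof -
  note delayed = path_support_delay[OF path_support_path[OF assms], of n]
  show "end_minus (delay n a) = end_minus a"
    using end_minus_eq[OF delayed] path_left[OF assms] by (simp add: delay_def)
  show "end_plus (delay n a) = end_plus a"
    using end_plus_eq[OF delayed] path_right[OF assms] by (simp add: delay_def)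
qed

text \<open>Translating everything at once would put three consecutive points of \<open>a\<close>
  into one square, which need not be linked. Delays at \<open>n\<close> and \<open>n + 1\<close>
  differ only at place \<open>n + 1\<close>, with values \<open>a n\<close> and
  \<open>a (n + 1)\<close>, so every square stays within two consecutive points.\<close>

lemma delay_homotopic2:
  assumes a: "a \<in> paths X" shows "(delay n a, a) \<in> homotopic2 X"
proof -
  have end_delay: "delay n a = a" if "rho_plus a \<le> n" for n
    using that path_right[OF a] by (auto simp: delay_def fun_eq_iff)
  have adjacent: "(delay n a, delay (n + 1) a) \<in> homotopic2 X" for n
  proof (rule homotopic2_adjacent)
    show "{delay n a i, delay n a (i + 1), delay (n + 1) a i, delay (n + 1) a (i + 1)} \<in> linked X" for i
      using path_linked[OF a, of "if i \<le> n then i else i - 1"]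
      by (rule linked_mono) (auto simp: delay_def)
  qed (simp_all add: a delay_in delay_ends)
  have "(delay n a, a) \<in> homotopic2 X" if "n \<le> rho_plus a" for n
    using that
  proof (induction rule: int_le_induct)
    case base
    show ?case using end_delay[of "rho_plus a"] homotopic2_refl[OF a] by simp
  next
    case (step i)
    then show ?case using adjacent[of "i - 1"] homotopic2_trans by auto
  qed
  moreover have "(delay n a, a) \<in> homotopic2 X" if "rho_plus a \<le> n" for n
    using that end_delay homotopic2_refl[OF a] by simp
  ultimately show ?thesis using linear by blast
qed

lemma shift_in:
  assumes "a \<in> paths X" shows "(\<lambda>i. a (i + k)) \<in> paths X"
proof (rule pathsI)
  show "{a (i + k), a (i + 1 + k)} \<in> linked X" for i
    using path_linked[OF assms, of "i + k"] by (simp add: algebra_simps)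
  show "path_support (\<lambda>i. a (i + k)) (rho_minus a - k) (rho_plus a - k)"
    using rho_le[OF assms] path_left[OF assms] path_right[OF assms]
    by (simp add: path_support_def)
qed

text \<open>A delay at the left end of the support translates by one place to the right. A
  translation to the left is undone by one to the right, so symmetry covers it.\<close>

lemma shift_homotopic2:
  assumes "a \<in> paths X" shows "((\<lambda>i. a (i + k)), a) \<in> homotopic2 X"
proof -
  have shift: "((\<lambda>i. a (i - int n)), a) \<in> homotopic2 X" if "a \<in> paths X" for n a
    using that
  proof (induction n arbitrary: a)
    case 0
    then show ?case by (simp add: homotopic2_refl)
  next
    case (Suc n)
    have "delay (rho_minus a) a = (\<lambda>i. a (i - 1))"
      using path_left[OF Suc.prems] by (auto simp: delay_def fun_eq_iff)
    then have "((\<lambda>i. a (i - 1)), a) \<in> homotopic2 X"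
      using delay_homotopic2[OF Suc.prems, of "rho_minus a"] by simp
    moreover have "((\<lambda>i. a (i - int n - 1)), (\<lambda>i. a (i - 1))) \<in> homotopic2 X"
      using Suc.IH[of "\<lambda>i. a (i - 1)"] shift_in[OF Suc.prems, of "-1"] by simp
    ultimately show ?case using homotopic2_trans by (fastforce simp: algebra_simps)
  qed
  show ?thesis
  proof (cases "k \<le> 0")
    case True
    then show ?thesis using shift[OF assms, of "nat (- k)"] by simp
  next
    case False
    then show ?thesis
      using homotopic2_sym[OF shift[OF shift_in[OF assms, of k], of "nat k"]] by simp
  qed
qed

section \<open>Equivalent edge paths have homotopic hats\<close>

lemma hat_in:
  assumes "u \<in> edge_paths X" shows "edge_path_hat u \<in> paths X"
proof (rule pathsI[OF _ path_support_hat])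
  fix i
  have ne: "u \<noteq> []" and points: "set u \<subseteq> points X"
    and link: "\<And>n. Suc n < length u \<Longrightarrow> {u ! n, u ! Suc n} \<in> linked X"
    using assms by (auto simp: edge_paths_def)
  show "{edge_path_hat u i, edge_path_hat u (i + 1)} \<in> linked X"
  proof (cases "0 \<le> i \<and> i + 1 \<le> int (length u - 1)")
    case True
    then have "Suc (nat i) < length u" by arith
    then show ?thesis
      using True link[of "nat i"] by (simp add: edge_path_hat_def nat_add_distrib)
  next
    case False
    then have "edge_path_hat u (i + 1) = edge_path_hat u i"
      by (auto simp: edge_path_hat_outer)
    moreover have "0 < length u" using ne by simp
    then have "nat (min (max 0 i) (int (length u - 1))) < length u" by arith
    then have "edge_path_hat u i \<in> set u" unfolding edge_path_hat_def by (rule nth_mem)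
    ultimately show ?thesis using points by (auto simp: linked_single_iff)
  qed
qed

lemma hat_path_edges_homotopic2:
  assumes "a \<in> paths X" shows "(edge_path_hat (path_edges a), a) \<in> homotopic2 X"
  unfolding path_edges_def edge_path_hat_segment[OF path_support_path[OF assms]]
  using assms by (rule shift_homotopic2)

lemma path_edges_hat_equiv:
  assumes "u \<in> edge_paths X" shows "(path_edges (edge_path_hat u), u) \<in> edge_equiv X"
  using path_edges_equiv[OF hat_in[OF assms] path_support_hat]
    segment_hat[OF edge_path_nonempty[OF assms]] by simp

lemma hat_repeat_homotopic2:
  assumes "pre @ x # post \<in> edge_paths X"
  shows "(edge_path_hat (pre @ x # x # post), edge_path_hat (pre @ x # post)) \<in> homotopic2 X"
  unfolding edge_path_hat_repeat by (rule delay_homotopic2[OF hat_in[OF assms]])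

text \<open>The two sequences differ in length, so \<open>(x, z)\<close> is stretched to
  \<open>(x, x, z)\<close> by a repetition. Replacing the middle \<open>x\<close> by
  \<open>y\<close> is then a change at one inner place, and the two squares that meet it have all
  their values in \<open>{x, y, z}\<close>.\<close>

lemma hat_triangle_homotopic2:
  assumes xyz: "{x, y, z} \<in> linked X" and in_paths: "pre @ x # y # z # post \<in> edge_paths X"
  shows "(edge_path_hat (pre @ x # y # z # post), edge_path_hat (pre @ x # z # post)) \<in> homotopic2 X"
proof -
  let ?a = "edge_path_hat (pre @ x # x # z # post)" and ?b = "edge_path_hat (pre @ x # y # z # post)"
  let ?n = "int (length pre)"
  have xz: "pre @ x # z # post \<in> edge_paths X"
    using simple_step_in(2)[OF simple_step_triangle[OF in_paths xyz]] .
  have xxz: "pre @ x # x # z # post \<in> edge_paths X"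
    using simple_step_in(2)[OF simple_step_repeat[OF xz]] .
  have a: "?a \<in> paths X" and b: "?b \<in> paths X" using xxz in_paths by (auto intro: hat_in)
  have b_upd: "?b = ?a(?n + 1 := y)"
    using edge_path_hat_replace[of "pre @ [x]" "z # post" y x] by (simp add: add.commute)
  have vals: "?a ?n = x" "?a (?n + 1) = x" "?a (?n + 2) = z"
    using edge_path_hat_inner[of "length pre" "pre @ x # x # z # post"]
      edge_path_hat_inner[of "length pre + 1" "pre @ x # x # z # post"]
      edge_path_hat_inner[of "length pre + 2" "pre @ x # x # z # post"]
    by (simp_all add: nth_append add.commute)
  have "(?a, ?b) \<in> homotopic2 X"
  proof (rule homotopic2_adjacent[OF a b])
    show "end_minus ?b = end_minus ?a" "end_plus ?b = end_plus ?a"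
      by (simp_all add: edge_path_hat_ends nth_append nth_Cons')
    fix i
    consider "i = ?n" | "i = ?n + 1" | "i \<noteq> ?n" "i \<noteq> ?n + 1" by blast
    then show "{?a i, ?a (i + 1), ?b i, ?b (i + 1)} \<in> linked X"
    proof cases
      case 1
      then have "{?a i, ?a (i + 1), ?b i, ?b (i + 1)} \<subseteq> {x, y, z}" using vals by (auto simp: b_upd)
      then show ?thesis using xyz linked_mono by blast
    next
      case 2
      then have "{?a i, ?a (i + 1), ?b i, ?b (i + 1)} \<subseteq> {x, y, z}" using vals by (auto simp: b_upd add.commute)
      then show ?thesis using xyz linked_mono by blast
    next
      case 3
      then have "{?a i, ?a (i + 1), ?b i, ?b (i + 1)} = {?a i, ?a (i + 1)}" by (auto simp: b_upd)
      then show ?thesis using path_linked[OF a] by simp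
    qed
  qed
  then show ?thesis
    using hat_repeat_homotopic2[OF xz] homotopic2_sym homotopic2_trans by blast
qed

lemma edge_equiv_imp_hat_homotopic2:
  assumes "(u, w) \<in> edge_equiv X"
  shows "(edge_path_hat u, edge_path_hat w) \<in> homotopic2 X"
  using assms
proof (induction rule: edge_equiv_induct)
  case (step u w)
  note u = simple_step_in(1)[OF step]
  from step show ?case
  proof (cases rule: simple_step_cases)
    case (repeat pre x post)
    then show ?thesis using u hat_repeat_homotopic2 homotopic2_sym by simp
  next
    case (triangle pre x y z post)
    then show ?thesis using u hat_triangle_homotopic2 by simp
  qed
qed (auto intro: homotopic2_refl hat_in homotopic2_sym homotopic2_trans)

text \<open>This is the condition \<open>R_iff\<close> of the transfer. Backwards, each path is
  homotopic to the hat of its restriction, and these hats are homotopic.\<close>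

lemma homotopic2_iff_edge_equiv:
  "(a, b) \<in> homotopic2 X \<longleftrightarrow>
     a \<in> paths X \<and> b \<in> paths X \<and> (path_edges a, path_edges b) \<in> edge_equiv X"
proof
  assume "(a, b) \<in> homotopic2 X"
  then show "a \<in> paths X \<and> b \<in> paths X \<and> (path_edges a, path_edges b) \<in> edge_equiv X"
    using homotopic2_imp_edge_equiv by (auto simp: homotopic2_iff)
next
  assume "a \<in> paths X \<and> b \<in> paths X \<and> (path_edges a, path_edges b) \<in> edge_equiv X"
  then have a: "(a, edge_path_hat (path_edges a)) \<in> homotopic2 X"
    and ab: "(edge_path_hat (path_edges a), edge_path_hat (path_edges b)) \<in> homotopic2 X"
    and b: "(edge_path_hat (path_edges b), b) \<in> homotopic2 X"
    using hat_path_edges_homotopic2 homotopic2_sym edge_equiv_imp_hat_homotopic2 by auto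
  show "(a, b) \<in> homotopic2 X"
    by (rule homotopic2_trans[OF a homotopic2_trans[OF ab b]])
qed

section \<open>Compatibility of restriction with the operations\<close>

lemma path_concat_in_equiv:
  assumes a: "a \<in> paths X" and b: "b \<in> paths X" and ends: "end_plus a = end_minus b"
  shows "path_concat a b \<in> paths X"
    "(path_edges (path_concat a b), edge_concat (path_edges a) (path_edges b)) \<in> edge_equiv X"
proof -
  have seam: "a (rho_plus a) = b (rho_minus b)"
    using ends by (simp add: end_plus_def end_minus_def)
  note concat = path_support_concat[OF path_support_path[OF a] path_support_path[OF b] refl refl seam]
  show in_paths: "path_concat a b \<in> paths X"
  proof (rule pathsI[OF _ concat(1)])
    fix i
    show "{path_concat a b i, path_concat a b (i + 1)} \<in> linked X"
    \<comment> \<open>The strict inequality puts \<open>i\<close> and \<open>i + 1\<close> both in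
      the first branch. At the seam itself the branches agree, so from there on the second formula
      serves for both.\<close>
    proof (cases "i < rho_plus a + rho_minus b")
      case True
      then show ?thesis
        using path_linked[OF a, of "i - rho_minus b"] by (simp add: path_concat_def algebra_simps)
    next
      case False
      then have "path_concat a b i = b (i - rho_plus a)"
        using seam by (cases "i = rho_plus a + rho_minus b") (auto simp: path_concat_def)
      then show ?thesis
        using False path_linked[OF b, of "i - rho_plus a"] by (simp add: path_concat_def algebra_simps)
    qed
  qed
  show "(path_edges (path_concat a b), edge_concat (path_edges a) (path_edges b)) \<in> edge_equiv X"
    using path_edges_equiv[OF in_paths concat(1)] concat(2) by (simp add: path_edges_def)
qed

lemma path_reverse_in_equiv:
  assumes "a \<in> paths X"
  shows "path_reverse a \<in> paths X" "(path_edges (path_reverse a), rev (path_edges a)) \<in> edge_equiv X"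
proof -
  note support = path_support_reverse[OF path_support_path[OF assms]]
  show in_paths: "path_reverse a \<in> paths X"
  proof (rule pathsI[OF _ support])
    show "{path_reverse a i, path_reverse a (i + 1)} \<in> linked X" for i
      using path_linked[OF assms, of "- i - 1"] by (simp add: path_reverse_def insert_commute)
  qed
  show "(path_edges (path_reverse a), rev (path_edges a)) \<in> edge_equiv X"
    using path_edges_equiv[OF in_paths support] map_upto_uminus[of a "rho_plus a" "rho_minus a"]
    by (simp add: path_edges_def path_reverse_def)
qed

lemma constant_path_in_equiv:
  assumes "x \<in> points X"
  shows "(\<lambda>_. x) \<in> paths X" "(path_edges (\<lambda>_. x), [x]) \<in> edge_equiv X"
proof -
  have support: "path_support (\<lambda>_. x) 0 0" by (simp add: path_support_def)
  show in_paths: "(\<lambda>_. x) \<in> paths X"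
    using assms by (intro pathsI[OF _ support]) (simp add: linked_singleton)
  show "(path_edges (\<lambda>_. x), [x]) \<in> edge_equiv X"
    using path_edges_equiv[OF in_paths support] by simp
qed

end

section \<open>The isomorphism of groupoids\<close>

theorem mainTheorem7:
  fixes X :: "'a scomplex"
  assumes "simplicial_complex X"
  shows "groupoids_isomorphic (edge_groupoid X) (fundamental_groupoid X) \<and>
    (\<forall>a \<in> edge_paths X. edge_path_hat a \<in> paths X) \<and>
    (\<exists>F. (\<forall>a \<in> edge_paths X. F (edge_class X a) = path_class X (edge_path_hat a)) \<and>
         groupoid_functor (edge_groupoid X) (fundamental_groupoid X) (\<lambda>x. x) F \<and>
         groupoid_iso (edge_groupoid X) (fundamental_groupoid X) (\<lambda>x. x) F)"
proof -
  interpret simplicial_complex X by (rule assms)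
  interpret E: setoid_groupoid "edge_paths X" "edge_equiv X" "points X" hd last edge_concat
    "\<lambda>x. [x]" rev
    by (rule setoid_groupoid_edge)
  \<comment> \<open>Restriction plays the part of \<Phi> and the hat construction that of \<Psi>:
    the laws travel from edge paths to paths, and the functor is induced by the hat.\<close>
  interpret P: setoid_groupoid_pullback "edge_paths X" "edge_equiv X" "points X" hd last
    edge_concat "\<lambda>x. [x]" rev "paths X" "homotopic2 X" end_minus end_plus path_concat
    "\<lambda>x _. x" path_reverse path_edges edge_path_hat
    by unfold_locales
      (simp_all add: homotopic2_iff_edge_equiv path_edges_in hd_path_edges last_path_edges
        path_concat_in_equiv path_reverse_in_equiv constant_path_in_equiv hat_in
        path_edges_hat_equiv)
  have E: "E.quotient = edge_groupoid X"
    by (simp add: E.quotient_def edge_groupoid_def edge_class_def)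
  have P: "P.quotient = fundamental_groupoid X"
    by (simp add: P.quotient_def fundamental_groupoid_def path_class_def)
  have iso: "groupoid_iso (edge_groupoid X) (fundamental_groupoid X) (\<lambda>x. x) P.lift_\<Psi>"
    using P.iso_lift_\<Psi> unfolding E P .
  then have "groupoid_functor (edge_groupoid X) (fundamental_groupoid X) (\<lambda>x. x) P.lift_\<Psi>"
    by (simp add: groupoid_iso_def)
  moreover have "P.lift_\<Psi> (edge_class X a) = path_class X (edge_path_hat a)"
    if "a \<in> edge_paths X" for a
    unfolding edge_class_def path_class_def by (rule P.lift_\<Psi>_class[OF that])
  moreover have "groupoids_isomorphic (edge_groupoid X) (fundamental_groupoid X)"
    unfolding groupoids_isomorphic_def using iso by blast
  ultimately show ?thesis
    using iso by (intro conjI ballI exI[of _ P.lift_\<Psi>]) (simp_all add: hat_in)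
qed

end
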